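(* Let $s,t$ be positive integers and let $n,k,r$ be integers with $n\ge k\ge 5$ and $r\ge 2$. Let $G$ be a 2-connected graph on $n$ vertices with $\delta(G)\ge r$, and put $h=\lfloor\frac{k-1}{2}\rfloor$. If $$N(K_{s,t},G)>\max\{g_{s,t}(n,k,r),\ g_{s,t}(n,k,h)\},$$ then $G$ contains a cycle of length at least $k$.
   Context: $N(K_{s,t},G)$ denotes the number of (not necessarily induced) copies of the complete bipartite graph $K_{s,t}$ in $G$; $\delta(G)$ is the minimum degree. For integers $n,k,a$ define $$g_{s,t}(n,k,a)=\begin{cases}\displaystyle\sum_{i=1}^{n-k+a}\binom{a}{s}\binom{n-s-i}{s-1}+\frac12\binom{k-a}{2s}\binom{2s}{s}, & s=t,\\[2mm] \displaystyle\sum_{i=1}^{n-k+a}\left(\binom{a}{s}\binom{n-s-i}{t-1}+\binom{a}{t}\binom{n-t-i}{s-1}\right)+\binom{k-a}{s+t}\binom{s+t}{s}, & s\neq t.\end{cases}$$ *)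

theory Defs
  imports Complex_Main "Graph_Theory.Graph_Theory"
begin

text \<open>
  A finite simple graph is a \<^locale>\<open>pair_graph\<close>: a finite, loopless, symmetric set of arcs
  without multiplicities, so that an edge \<open>uv\<close> is the pair of arcs \<open>(u,v)\<close>, \<open>(v,u)\<close>.
  In this representation a closed walk \<open>u,v,u\<close> counts as a cycle of length 2; the library's
  cycles of length at least 3 are exactly the cycles of the simple graph.
\<close>

definition k_connected :: "nat \<Rightarrow> ('a, 'b) pre_digraph \<Rightarrow> bool" where
  "k_connected k G \<longleftrightarrow>
     k < card (verts G) \<and>
     (\<forall>X \<subseteq> verts G. card X < k \<longrightarrow> connected (G \<restriction> (verts G - X)))"

text \<open>By symmetry the degree of a vertex is its out-degree.\<close>

definition min_degree :: "('a, 'b) pre_digraph \<Rightarrow> nat" where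
  "min_degree G = Min (out_degree G ` verts G)"

text \<open>
  A copy is a subgraph, so for \<open>s = t\<close> exchanging the two sides does not give a new copy.
\<close>

definition num_bipartite_copies :: "nat \<Rightarrow> nat \<Rightarrow> 'a pair_pre_digraph \<Rightarrow> nat" where
  "num_bipartite_copies s t G =
     card {H :: 'a pair_pre_digraph.
             subgraph (with_proj H) (with_proj G) \<and> complete_bipartite_digraph s t (with_proj H)}"

text \<open>
  Binomial coefficients with an integer upper entry, read combinatorially: they vanish when
  the upper entry is negative (unlike \<open>gchoose\<close>).
\<close>

definition int_binom :: "int \<Rightarrow> nat \<Rightarrow> real" where
  "int_binom m j = (if m < 0 then 0 else real (nat m choose j))"

text \<open>The function \<open>g\<^sub>s\<^sub>,\<^sub>t(n,k,a)\<close>, for \<open>s, t \<ge> 1\<close>.\<close>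

definition g :: "nat \<Rightarrow> nat \<Rightarrow> int \<Rightarrow> int \<Rightarrow> int \<Rightarrow> real" where
  "g s t n k a =
     (if s = t then
        (\<Sum>i = 1..n - k + a. int_binom a s * int_binom (n - int s - i) (s - 1))
        + 1 / 2 * int_binom (k - a) (2 * s) * real ((2 * s) choose s)
      else
        (\<Sum>i = 1..n - k + a. int_binom a s * int_binom (n - int s - i) (t - 1)
                             + int_binom a t * int_binom (n - int t - i) (s - 1))
        + int_binom (k - a) (s + t) * real ((s + t) choose s))"

end

theory Submission
  imports Defs
begin

text \<open>
  Kopylov's method. Suppose there is no cycle of length at least \<open>k\<close>; adding edges as long as this
  stays true, we may assume that any two nonadjacent vertices are joined by a path on at least \<open>k\<close>
  vertices. In a 2-connected graph, a path on at least \<open>k\<close> vertices whose ends have at least \<open>k\<close>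
  neighbours on it, counted together, yields a cycle of length at least \<open>k\<close>. Let \<open>W\<close> be the set left after
  successively deleting vertices of degree at most \<open>h\<close>. If \<open>W\<close> is empty, counting the copies
  destroyed by each deletion gives the bound \<open>g\<^sub>s\<^sub>,\<^sub>t(n,k,h)\<close>. Otherwise, applying the cycle
  criterion to longest paths with both ends in \<open>W\<close> shows that \<open>W\<close> is a clique; put \<open>a = k - |W|\<close>, so that
  \<open>a \<le> h\<close>. Longest paths from \<open>W\<close> to the core obtained by deleting only vertices of
  degree at most \<open>a\<close> show that this core is \<open>W\<close> as well, whence \<open>r \<le> a\<close> and the count is at most
  \<open>g\<^sub>s\<^sub>,\<^sub>t(n,k,a)\<close>. Finally \<open>g\<^sub>s\<^sub>,\<^sub>t(n,k,a)\<close> is convex in \<open>a\<close> on \<open>[r,h]\<close>.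
\<close>

section \<open>Paths and linkages\<close>

definition simple_path :: "'a set \<Rightarrow> 'a rel \<Rightarrow> 'a list \<Rightarrow> bool" where
  "simple_path V E xs \<longleftrightarrow>
     xs \<noteq> [] \<and> distinct xs \<and> set xs \<subseteq> V \<and> successively (\<lambda>x y. (x, y) \<in> E) xs"

text \<open>For symmetric \<open>E\<close> a list of two adjacent vertices counts as a cycle, as it
  does in pair graphs. This is harmless, since only cycles of length at least 5 matter in the
  end.\<close>

definition simple_cycle :: "'a set \<Rightarrow> 'a rel \<Rightarrow> 'a list \<Rightarrow> bool" where
  "simple_cycle V E c \<longleftrightarrow> simple_path V E c \<and> (last c, hd c) \<in> E"

definition no_cutvertex :: "'a set \<Rightarrow> 'a rel \<Rightarrow> bool" where
  "no_cutvertex V E \<longleftrightarrow>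
     (\<forall>y\<in>V. \<forall>u\<in>V - {y}. \<forall>v\<in>V - {y}.
        \<exists>W. simple_path V E W \<and> hd W = u \<and> last W = v \<and> y \<notin> set W)"

text \<open>Two disjoint paths from \<open>A\<close> to \<open>B\<close> whose four ends include the prescribed vertices \<open>a\<close> and \<open>b\<close>.\<close>

definition linkage ::
  "'a set \<Rightarrow> 'a rel \<Rightarrow> 'a set \<Rightarrow> 'a \<Rightarrow> 'a set \<Rightarrow> 'a \<Rightarrow> 'a list \<Rightarrow> 'a list \<Rightarrow> bool" where
  "linkage V E A a B b R S \<longleftrightarrow>
     simple_path V E R \<and> simple_path V E S \<and> set R \<inter> set S = {} \<and>
     hd R \<in> A \<and> hd S \<in> A \<and> set R \<inter> A \<subseteq> {hd R} \<and> set S \<inter> A \<subseteq> {hd S} \<and>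
     last R \<in> B \<and> last S \<in> B \<and> set R \<inter> B \<subseteq> {last R} \<and> set S \<inter> B \<subseteq> {last S} \<and>
     a \<in> {hd R, hd S} \<and> b \<in> {last R, last S}"

section \<open>Splitting, reversing and joining paths\<close>

lemma simple_pathD:
  assumes "simple_path V E xs"
  shows "xs \<noteq> []" "distinct xs" "set xs \<subseteq> V" "successively (\<lambda>x y. (x, y) \<in> E) xs"
    "hd xs \<in> set xs" "last xs \<in> set xs"
  using assms by (auto simp: simple_path_def)

lemma simple_path_append_iff:
  "xs \<noteq> [] \<Longrightarrow> ys \<noteq> [] \<Longrightarrow> simple_path V E (xs @ ys) \<longleftrightarrow>
     simple_path V E xs \<and> simple_path V E ys \<and> set xs \<inter> set ys = {} \<and> (last xs, hd ys) \<in> E"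
  by (auto simp: simple_path_def successively_append_iff)

lemma simple_path_mono: "simple_path V E xs \<Longrightarrow> E \<subseteq> F \<Longrightarrow> simple_path V F xs"
  unfolding simple_path_def by (blast intro: successively_mono)

lemma simple_path_appendD1: "simple_path V E (xs @ ys) \<Longrightarrow> xs \<noteq> [] \<Longrightarrow> simple_path V E xs"
  by (auto simp: simple_path_def successively_append_iff)

lemma simple_path_appendD2: "simple_path V E (xs @ ys) \<Longrightarrow> ys \<noteq> [] \<Longrightarrow> simple_path V E ys"
  by (auto simp: simple_path_def successively_append_iff)

lemma simple_path_rev: "sym E \<Longrightarrow> simple_path V E (rev xs) \<longleftrightarrow> simple_path V E xs"
  by (auto simp: simple_path_def sym_def elim!: successively_mono)

lemma simple_path_snoc:
  "simple_path V E xs \<Longrightarrow> (last xs, v) \<in> E \<Longrightarrow> v \<in> V \<Longrightarrow> v \<notin> set xs \<Longrightarrow> simple_path V E (xs @ [v])"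
  by (auto simp: simple_path_def successively_append_iff)

lemma simple_path_join:
  assumes X: "simple_path V E X" and Y: "simple_path V E Y"
    and "last X = hd Y" and int: "set X \<inter> set Y \<subseteq> {hd Y}"
  shows "simple_path V E (X @ tl Y)" "hd (X @ tl Y) = hd X" "last (X @ tl Y) = last Y"
    "set (X @ tl Y) = set X \<union> set Y"
proof -
  obtain y ys where Yy: "Y = y # ys"
    using Y by (cases Y) (auto simp: simple_path_def)
  have "X \<noteq> []"
    using X by (simp add: simple_path_def)
  have y: "last X = y" "y \<in> set X"
    using assms(3) \<open>X \<noteq> []\<close> Yy last_in_set[of X] by auto
  have "y \<notin> set ys" using Y Yy by (simp add: simple_path_def)
  with int Yy have "set X \<inter> set ys = {}" by auto
  then show "simple_path V E (X @ tl Y)"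
    using X Y Yy y by (cases ys) (auto simp: simple_path_def successively_append_iff)
  show "hd (X @ tl Y) = hd X" using \<open>X \<noteq> []\<close> by simp
  show "last (X @ tl Y) = last Y" using y Yy by auto
  show "set (X @ tl Y) = set X \<union> set Y" using y Yy by auto
qed

text \<open>A shortest path from \<open>S\<close> to \<open>T\<close> avoiding \<open>y\<close>
  works: another vertex of \<open>S\<close> or \<open>T\<close> on it would allow it to be cut
  short.\<close>

lemma simple_path_between_sets:
  assumes nc: "no_cutvertex V E" and "y \<in> V" and "S \<subseteq> V" "T \<subseteq> V" "S - {y} \<noteq> {}" "T - {y} \<noteq> {}"
  obtains W where "simple_path V E W" "hd W \<in> S" "last W \<in> T"
    "set W \<inter> S \<subseteq> {hd W}" "set W \<inter> T \<subseteq> {last W}" "y \<notin> set W"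
proof -
  define Q where "Q W \<longleftrightarrow> simple_path V E W \<and> hd W \<in> S \<and> last W \<in> T \<and> y \<notin> set W" for W
  have "\<exists>W. Q W"
  proof -
    obtain u v where uv: "u \<in> S - {y}" "v \<in> T - {y}" using assms(5,6) by blast
    then have "u \<in> V - {y}" "v \<in> V - {y}" using assms(3,4) by auto
    then obtain W where "simple_path V E W" "hd W = u" "last W = v" "y \<notin> set W"
      using nc \<open>y \<in> V\<close> unfolding no_cutvertex_def by blast
    then show ?thesis using uv by (auto simp: Q_def)
  qed
  then obtain W where W: "Q W" and min: "\<And>W'. length W' < length W \<Longrightarrow> \<not> Q W'"
    using ex_has_least_nat[of Q _ length] by (metis leD)
  note p = simple_pathD[of V E W]
  have path: "simple_path V E W" using W by (simp add: Q_def)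
  have "z = hd W" if z: "z \<in> set W" "z \<in> S" for z
  proof (rule ccontr)
    assume "z \<noteq> hd W"
    obtain X Y where XY: "W = X @ z # Y" using z by (meson split_list)
    with \<open>z \<noteq> hd W\<close> have "X \<noteq> []" by auto
    have "Q (z # Y)"
      using W z XY simple_path_appendD2[of V E X "z # Y"] by (auto simp: Q_def split: if_splits)
    then show False using min[of "z # Y"] XY \<open>X \<noteq> []\<close> by simp
  qed
  moreover have "z = last W" if z: "z \<in> set W" "z \<in> T" for z
  proof (rule ccontr)
    assume "z \<noteq> last W"
    obtain X Y where XY: "W = X @ z # Y" using z by (meson split_list)
    with \<open>z \<noteq> last W\<close> have "Y \<noteq> []" by auto
    have "Q (X @ [z])"
      using W z XY simple_path_appendD1[of V E "X @ [z]" Y]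
      by (cases X) (auto simp: Q_def)
    then show False using min[of "X @ [z]"] XY \<open>Y \<noteq> []\<close> by simp
  qed
  ultimately show ?thesis
    using W p[OF path] that[of W] unfolding Q_def by blast
qed

section \<open>Two disjoint paths between segments of a path\<close>

lemma linkage_commute: "linkage V E A a B b R S \<longleftrightarrow> linkage V E A a B b S R"
  unfolding linkage_def by auto

text \<open>The common vertex \<open>a\<close> is itself one of the two paths. As \<open>a\<close>
  is not a cut vertex, the other path can avoid it.\<close>

lemma linkage_base:
  assumes nc: "no_cutvertex V E" and "insert a (A \<union> B) \<subseteq> V"
    and "A \<noteq> {}" "B \<noteq> {}" "a \<notin> A" "a \<notin> B"
  shows "\<exists>R S. linkage V E (insert a A) a (insert a B) a R S"
proof -
  obtain W where W: "simple_path V E W" "hd W \<in> A" "last W \<in> B"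
      "set W \<inter> A \<subseteq> {hd W}" "set W \<inter> B \<subseteq> {last W}" "a \<notin> set W"
    by (rule simple_path_between_sets[OF nc, of a A B]) (use assms in auto)
  then have "linkage V E (insert a A) a (insert a B) a [a] W"
    using assms by (auto simp: linkage_def simple_path_def)
  then show ?thesis by blast
qed

text \<open>If both \<open>b\<close> and \<open>b'\<close> are ends, a path avoiding \<open>b'\<close> and leaving \<open>A \<union> R \<union> S\<close> for \<open>C\<close> frees one of
  them: reroute the path it leaves, and keep the other one or extend it by the edge \<open>bb'\<close>. If it
  leaves \<open>A\<close> off both paths, it replaces the one that does not start at \<open>a\<close>.\<close>

lemma linkage_step_aux:
  assumes nc: "no_cutvertex V E" and L: "linkage V E A a (insert b (insert b' C)) b R S"
    and R: "last R = b" and sub: "A \<subseteq> V" "b' \<in> V" "C \<subseteq> V" and "C \<noteq> {}"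
    and e: "(b, b') \<in> E" and ni: "b \<noteq> b'" "b \<notin> C" "b' \<notin> C" "b' \<notin> A" and AC: "A \<inter> C = {}"
  shows "\<exists>R' S'. linkage V E A a (insert b' C) b' R' S'"
proof -
  from L have pR: "simple_path V E R" and pS: "simple_path V E S" and dis: "set R \<inter> set S = {}"
    and RA: "hd R \<in> A" "set R \<inter> A \<subseteq> {hd R}" and SA: "hd S \<in> A" "set S \<inter> A \<subseteq> {hd S}"
    and a: "a \<in> {hd R, hd S}"
    and RB: "set R \<inter> insert b (insert b' C) \<subseteq> {b}"
    and SB: "last S \<in> insert b (insert b' C)" "set S \<inter> insert b (insert b' C) \<subseteq> {last S}"
    using R by (auto simp: linkage_def)
  note pRD = simple_pathD[OF pR] and pSD = simple_pathD[OF pS]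
  have Sb: "last S \<noteq> b" "b \<notin> set S"
    using dis pRD(6) pSD(6) R by (metis disjoint_iff)+
  have RC: "set R \<inter> insert b' C = {}" using RB ni by auto
  have pR': "simple_path V E (R @ [b'])"
    using simple_path_snoc[OF pR, of b'] R e sub RC by auto
  have SB': "last S \<in> insert b' C" "set S \<inter> insert b' C \<subseteq> {last S}" using SB Sb by auto
  show ?thesis
  proof (cases "last S = b'")
    \<comment> \<open>Here \<open>S\<close> already ends in \<open>C\<close>, so it is enough to
      extend \<open>R\<close> by the edge to \<open>b'\<close>.\<close>
    case False
    then have "b' \<notin> set S" using SB by blast
    then have "linkage V E A a (insert b' C) b' (R @ [b']) S"
      using pR' pS dis RA SA a RC SB' ni pRD unfolding linkage_def by auto
    then show ?thesis by blast
  next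
    case True
    then have SC: "set S \<inter> C = {}" using SB' ni by auto
    have "A \<union> set R \<union> set S \<subseteq> V" using pRD(3) pSD(3) sub by auto
    moreover have "A \<union> set R \<union> set S - {b'} \<noteq> {}" using pRD(6) R ni by auto
    moreover have "C - {b'} \<noteq> {}" using \<open>C \<noteq> {}\<close> ni by auto
    ultimately obtain W where W: "simple_path V E W" "set W \<inter> (A \<union> set R \<union> set S) \<subseteq> {hd W}"
        "set W \<inter> C \<subseteq> {last W}" "b' \<notin> set W" "hd W \<in> A \<union> set R \<union> set S" "last W \<in> C"
      using simple_path_between_sets[OF nc \<open>b' \<in> V\<close> _ \<open>C \<subseteq> V\<close>] by metis
    note pWD = simple_pathD[OF W(1)]
    have zb: "hd W \<noteq> b'" using W(4) pWD(5) by metis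
    \<comment> \<open>Follow \<open>X\<close> up to the start of \<open>W\<close>, then follow
      \<open>W\<close>. Since \<open>W\<close> does not start at \<open>b'\<close>, this cuts off
      \<open>b'\<close> whenever \<open>X\<close> ends there.\<close>
    have splice: "\<exists>Q. simple_path V E Q \<and> hd Q = hd X \<and> last Q = last W \<and> set W \<subseteq> set Q \<and>
        set Q \<subseteq> set X \<union> set W \<and> (b' = last X \<longrightarrow> b' \<notin> set Q)"
      if pX: "simple_path V E X" and XS: "set X \<subseteq> A \<union> set R \<union> set S" and z: "hd W \<in> set X" for X
    proof -
      obtain Y Z where X: "X = Y @ hd W # Z" using z by (meson split_list)
      have pY: "simple_path V E (Y @ [hd W])"
        using pX X simple_path_appendD1[of V E "Y @ [hd W]" Z] by simp
      have int: "set (Y @ [hd W]) \<inter> set W \<subseteq> {hd W}" using W(2) XS X by auto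
      note j = simple_path_join[OF pY W(1) _ int]
      have "hd (Y @ [hd W]) = hd X" using X by (cases Y) auto
      moreover have "b' \<notin> set Y" if "b' = last X"
        using that pX X zb by (cases Z rule: rev_cases) (auto simp: simple_path_def)
      ultimately show ?thesis
        using j W(4) zb X by (intro exI[of _ "(Y @ [hd W]) @ tl W"]) auto
    qed
    consider "hd W \<in> set R" | "hd W \<in> set S" | "hd W \<in> A" "hd W \<notin> set R" "hd W \<notin> set S"
      using W(5) by auto
    then show ?thesis
    proof cases
      case 1
      then obtain Q where Q: "simple_path V E Q" "hd Q = hd R" "last Q = last W" "set W \<subseteq> set Q"
          "set Q \<subseteq> set R \<union> set W" 
        using splice[OF pR] by auto
      have "set W \<inter> set S = {}" using W(2) 1 dis by auto
      moreover have "set W \<inter> A \<subseteq> {hd R}" using W(2) 1 RA by blast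
      moreover have "hd Q \<in> set Q" using simple_pathD[OF Q(1)] by auto
      ultimately have "linkage V E A a (insert b' C) b' Q S"
        using Q pS dis RA SA a RC SB' W(3,4,6) True unfolding linkage_def by auto
      then show ?thesis by blast
    next
      case 2
      then obtain Q where Q: "simple_path V E Q" "hd Q = hd S" "last Q = last W" "set W \<subseteq> set Q"
          "set Q \<subseteq> set S \<union> set W" "b' \<notin> set Q"
        using splice[OF pS] True by auto
      have "set W \<inter> set R = {}" using W(2) 2 dis by auto
      moreover have "set W \<inter> A \<subseteq> {hd S}" using W(2) 2 SA by blast
      moreover have "hd Q \<in> set Q" using simple_pathD[OF Q(1)] by auto
      ultimately have "linkage V E A a (insert b' C) b' (R @ [b']) Q"
        using Q pR' dis RA SA a RC SC W(3,4,6) ni pRD unfolding linkage_def by auto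
      then show ?thesis by blast
    next
      case 3
      then have WR: "set W \<inter> set R = {}" and WS: "set W \<inter> set S = {}" and WA: "set W \<inter> A \<subseteq> {hd W}"
        using W(2) by auto
      show ?thesis
      proof (cases "a = hd R")
        case True
        then have "linkage V E A a (insert b' C) b' (R @ [b']) W"
          using pR' W WR WA 3(1) RA RC ni pRD unfolding linkage_def by auto
        then show ?thesis by blast
      next
        case False
        then have "linkage V E A a (insert b' C) b' W S"
          using pS W WS WA 3(1) SA SB' True a unfolding linkage_def by auto
        then show ?thesis by blast
      qed
    qed
  qed
qed

lemma linkage_step:
  assumes nc: "no_cutvertex V E" and L: "linkage V E A a (insert b (insert b' C)) b R S"
    and "A \<subseteq> V" "b' \<in> V" "C \<subseteq> V" "C \<noteq> {}" "(b, b') \<in> E"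
    and "b \<noteq> b'" "b \<notin> C" "b' \<notin> C" "b' \<notin> A" "A \<inter> C = {}"
  shows "\<exists>R' S'. linkage V E A a (insert b' C) b' R' S'"
proof (cases "last R = b")
  case True
  show ?thesis by (rule linkage_step_aux[OF nc L True assms(3-)])
next
  case False
  then have "last S = b" using L by (auto simp: linkage_def)
  then show ?thesis
    using linkage_step_aux[OF nc L[unfolded linkage_commute[of _ _ _ _ _ _ R S]]] assms(3-) by blast
qed

text \<open>Induction on \<open>j\<close>: the final segment loses its first vertex
  \<open>P ! j\<close>, the prescribed end, which is adjacent to the new one
  \<open>P ! Suc j\<close>. The bounds \<open>1 \<le> p\<close> and \<open>Suc j < length P\<close>
  keep both segments from being single vertices.\<close>

lemma linkage_along_path:
  assumes nc: "no_cutvertex V E" and P: "simple_path V E P"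
    and "1 \<le> p" "p \<le> j" "Suc j < length P"
  shows "\<exists>R S. linkage V E (set (take (Suc p) P)) (P ! p) (set (drop j P)) (P ! j) R S"
  using assms(4,5)
proof (induction j rule: dec_induct)
  case base
  note D = simple_pathD[OF P]
  have P_eq: "P = take p P @ P ! p # drop (Suc p) P" using base by (simp add: id_take_nth_drop)
  then have dist: "distinct (take p P @ P ! p # drop (Suc p) P)" using D(2) by simp
  have sub: "set (take p P) \<union> set (drop (Suc p) P) \<subseteq> V" "P ! p \<in> V"
    using D(3) base set_take_subset[of p P] set_drop_subset[of "Suc p" P] nth_mem[of p P] by auto
  have ne: "set (take p P) \<noteq> {}" "set (drop (Suc p) P) \<noteq> {}" using base \<open>1 \<le> p\<close> by auto
  have "set (take (Suc p) P) = insert (P ! p) (set (take p P))"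
    using base by (simp add: take_Suc_conv_app_nth)
  moreover have "set (drop p P) = insert (P ! p) (set (drop (Suc p) P))"
    using base by (simp flip: Cons_nth_drop_Suc)
  ultimately show ?case
    using linkage_base[OF nc, of "P ! p" "set (take p P)" "set (drop (Suc p) P)"] ne dist sub by auto
next
  case (step j)
  note D = simple_pathD[OF P]
  obtain R S where L: "linkage V E (set (take (Suc p) P)) (P ! p) (set (drop j P)) (P ! j) R S"
    using step by auto
  have dr: "set (drop j P) = insert (P ! j) (insert (P ! Suc j) (set (drop (Suc (Suc j)) P)))"
    "set (drop (Suc j) P) = insert (P ! Suc j) (set (drop (Suc (Suc j)) P))"
    using step by (simp_all flip: Cons_nth_drop_Suc)
  have "P = take (Suc j) P @ drop (Suc j) P" by simp
  then have dis: "set (take (Suc j) P) \<inter> set (drop (Suc j) P) = {}"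
    using D(2) by (metis distinct_append)
  have jin: "P ! j \<in> set (take (Suc j) P)" using step by (simp add: take_Suc_conv_app_nth)
  have sub: "set (take (Suc p) P) \<subseteq> set (take (Suc j) P)"
    using step by (intro set_take_subset_set_take) auto
  have "distinct (drop (Suc j) P)" using D(2) by simp
  then have "P ! Suc j \<notin> set (drop (Suc (Suc j)) P)"
    using step by (simp flip: Cons_nth_drop_Suc)
  moreover have "(P ! j, P ! Suc j) \<in> E"
    using D(4) step by (simp add: successively_conv_nth)
  moreover have "set (drop (Suc (Suc j)) P) \<noteq> {}" using step by auto
  moreover have "set (take (Suc p) P) \<subseteq> V" "P ! Suc j \<in> V" "set (drop (Suc (Suc j)) P) \<subseteq> V"
    using D(3) step set_take_subset[of "Suc p" P] set_drop_subset[of "Suc (Suc j)" P] by auto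
  ultimately show ?case
    unfolding dr(2)
    using dis jin sub dr(2) by (intro linkage_step[OF nc L[unfolded dr(1)]]) auto
qed

section \<open>Closing linkages up to cycles\<close>

lemma two_paths_cycle:
  assumes "sym E" and X: "simple_path V E X" and Y: "simple_path V E Y"
    and h: "hd Y = hd X" and l: "last Y = last X" and "hd X \<noteq> last X"
    and int: "set X \<inter> set Y \<subseteq> {hd X, last X}"
  shows "\<exists>c. simple_cycle V E c \<and> set X \<subseteq> set c"
proof -
  \<comment> \<open>The cycle is \<open>X\<close> followed by the interior \<open>M\<close> of
    \<open>Y\<close> in reverse. If \<open>M\<close> is empty, the single edge \<open>Y\<close>
    closes \<open>X\<close>.\<close>
  obtain M where M: "Y = hd X # M @ [last X]"
  proof (cases Y)
    case (Cons y ys)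
    with h l \<open>hd X \<noteq> last X\<close> have "ys \<noteq> []" by auto
    then have "ys = butlast ys @ [last X]" using Cons l by (metis append_butlast_last_id last_ConsR)
    then show ?thesis using that Cons h by auto
  qed (use Y in \<open>simp add: simple_path_def\<close>)
  show ?thesis
  proof (cases "M = []")
    case True
    then have "(last X, hd X) \<in> E" using Y M \<open>sym E\<close> by (auto simp: simple_path_def sym_def)
    then show ?thesis using X by (auto simp: simple_cycle_def)
  next
    case False
    have "simple_path V E (M @ [last X])"
      using Y M False simple_path_appendD2[of V E "[hd X]" "M @ [last X]"] by simp
    then have pM: "simple_path V E M" and ml: "(last M, last X) \<in> E"
      using False by (auto simp: simple_path_append_iff)
    have mh: "(hd X, hd M) \<in> E" using Y M False by (cases M) (auto simp: simple_path_def)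
    have "hd X \<notin> set M" "last X \<notin> set M" "set M \<subseteq> set Y" using Y M by (auto simp: simple_path_def)
    then have "set X \<inter> set M = {}" using int by blast
    then have "simple_path V E (X @ rev M)"
      using X pM ml False \<open>sym E\<close>
      by (auto simp: simple_path_append_iff simple_path_rev simple_pathD hd_rev dest: symD)
    moreover have "(last (X @ rev M), hd (X @ rev M)) \<in> E"
      using mh False simple_pathD(1)[OF X] \<open>sym E\<close> by (auto simp: last_rev dest: symD)
    ultimately show ?thesis by (auto simp: simple_cycle_def intro!: exI[of _ "X @ rev M"])
  qed
qed

text \<open>Walk from \<open>z\<close> back to the start of \<open>A\<close>, and jump over to its first neighbour beyond \<open>z\<close>.\<close>

lemma path_covering_neighbours:
  assumes "sym E" and A: "simple_path V E A" and cl: "(hd A, last A) \<in> E"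
    and z: "z \<in> set A" "z \<noteq> last A"
  shows "\<exists>D. simple_path V E D \<and> hd D = z \<and> last D = last A \<and> set D \<subseteq> set A \<and>
    insert (hd A) (E `` {hd A} \<inter> set A) \<subseteq> set D"
proof -
  obtain X Y where XY: "A = X @ z # Y" using z by (meson split_list)
  with z have "Y \<noteq> []" by auto
  then have lA: "last A = last Y" using XY by simp
  \<comment> \<open>\<open>F\<close> begins at the first neighbour of \<open>hd A\<close> beyond
    \<open>z\<close>. It is nonempty because \<open>last A\<close> is such a neighbour.\<close>
  define F where "F = dropWhile (\<lambda>y. (hd A, y) \<notin> E) Y"
  have "last Y \<in> set Y" using \<open>Y \<noteq> []\<close> by simp
  then have Fne: "F \<noteq> []" using cl lA unfolding F_def by (auto simp: dropWhile_eq_Nil_conv)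
  have YF: "Y = takeWhile (\<lambda>y. (hd A, y) \<notin> E) Y @ F" by (simp add: F_def)
  have FE: "(hd A, hd F) \<in> E"
    using hd_dropWhile[of "\<lambda>y. (hd A, y) \<notin> E" Y] Fne by (simp add: F_def)
  have lF: "last F = last A" using Fne YF lA by (metis last_appendR)
  have pX: "simple_path V E (X @ [z])"
    using A XY simple_path_appendD1[of V E "X @ [z]" Y] by simp
  have pF: "simple_path V E F"
    using A XY YF Fne simple_path_appendD2[of V E "X @ z # takeWhile (\<lambda>y. (hd A, y) \<notin> E) Y" F] by simp
  have "set (X @ [z]) \<inter> set F = {}"
    using A XY YF by (auto simp: simple_path_def F_def dest: set_dropWhileD)
  moreover have hX: "hd (X @ [z]) = hd A" using XY by (cases X) auto
  ultimately have "simple_path V E (rev (X @ [z]) @ F)"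
    using pX pF FE Fne simple_path_rev[OF \<open>sym E\<close>, of V "X @ [z]"]
    by (subst simple_path_append_iff) (auto simp: last_rev simp del: rev_append)
  moreover have "set F \<subseteq> set Y" by (auto simp: F_def dest: set_dropWhileD)
  moreover have "E `` {hd A} \<inter> set Y \<subseteq> set F"
  proof
    fix y assume "y \<in> E `` {hd A} \<inter> set Y"
    then show "y \<in> set F"
      by (metis F_def IntE Image_singleton_iff UnE YF set_append set_takeWhileD)
  qed
  moreover have "hd A \<in> set (X @ [z])" using hX hd_in_set[of "X @ [z]"] by simp
  ultimately show ?thesis
    using XY lF Fne by (intro exI[of _ "rev (X @ [z]) @ F"]) auto
qed

text \<open>The cycle runs from \<open>hd S\<close> inside \<open>A\<close> to \<open>last A\<close>
  (path \<open>D\<close>), along \<open>R\<close>, inside \<open>B\<close> from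
  \<open>last R\<close> to \<open>last S\<close> (path \<open>F\<close>), and back along
  \<open>S\<close>. \<open>D\<close> and \<open>F\<close> are chosen to collect the neighbours of
  the outer ends.\<close>

lemma linkage_cycle_aux:
  assumes "sym E" and A: "simple_path V E A" and B: "simple_path V E B"
    and clA: "(hd A, last A) \<in> E" and clB: "(last B, hd B) \<in> E"
    and AB: "set A \<inter> set B \<subseteq> {last A} \<inter> {hd B}"
    and L: "linkage V E (set A) (last A) (set B) (hd B) R S" and R: "hd R = last A"
  shows "\<exists>c. simple_cycle V E c \<and> insert (hd A) (E `` {hd A} \<inter> set A) \<subseteq> set c \<and>
    insert (last B) (E `` {last B} \<inter> set B) \<subseteq> set c"
proof -
  from L have pR: "simple_path V E R" and pS: "simple_path V E S" and dis: "set R \<inter> set S = {}"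
    and RA: "hd R \<in> set A" "set R \<inter> set A \<subseteq> {hd R}"
    and SA: "hd S \<in> set A" "set S \<inter> set A \<subseteq> {hd S}"
    and RB: "last R \<in> set B" "set R \<inter> set B \<subseteq> {last R}"
    and SB: "last S \<in> set B" "set S \<inter> set B \<subseteq> {last S}"
    and b: "hd B \<in> {last R, last S}"
    by (auto simp: linkage_def)
  note pRD = simple_pathD[OF pR] and pSD = simple_pathD[OF pS]
  have "hd S \<in> set A" using SA by auto
  moreover have "hd S \<noteq> last A" using R dis pRD(5) pSD(5) by (metis disjoint_iff)
  ultimately obtain D where D: "simple_path V E D" "hd D = hd S" "last D = hd R" "set D \<subseteq> set A"
      "insert (hd A) (E `` {hd A} \<inter> set A) \<subseteq> set D"
    using path_covering_neighbours[OF \<open>sym E\<close> A clA] R by metis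
  have B': "simple_path V E (rev B)" "(hd (rev B), last (rev B)) \<in> E" "hd (rev B) = last B" "last (rev B) = hd B"
    using B clB simple_path_rev[OF \<open>sym E\<close>] by (auto simp: hd_rev last_rev)
  note cov = path_covering_neighbours[OF \<open>sym E\<close> B'(1,2), unfolded B'(3,4) set_rev]
  have lne: "last R \<noteq> last S" using dis pRD(6) pSD(6) by (metis disjoint_iff)
  \<comment> \<open>The covering path in the reversed \<open>B\<close> ends at \<open>hd B\<close>,
    so it must start at the other end of the linkage. Depending on which of \<open>R\<close> and
    \<open>S\<close> ends at \<open>hd B\<close>, it is then reversed.\<close>
  obtain F where F: "simple_path V E F" "hd F = last R" "last F = last S" "set F \<subseteq> set B"
      "insert (last B) (E `` {last B} \<inter> set B) \<subseteq> set F"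
  proof (cases "hd B = last R")
    case True
    have "last S \<in> set B" using SB by auto
    then obtain F where "simple_path V E F" "hd F = last S" "last F = last R" "set F \<subseteq> set B"
      "insert (last B) (E `` {last B} \<inter> set B) \<subseteq> set F" using cov[of "last S"] lne True by metis
    then show ?thesis using that[of "rev F"] simple_path_rev[OF \<open>sym E\<close>] by (auto simp: hd_rev last_rev)
  next
    case False
    have "last R \<in> set B" using RB by auto
    moreover have "hd B = last S" using b False by simp
    ultimately show ?thesis using cov[of "last R"] lne that by metis
  qed
  have "set D \<inter> set R \<subseteq> {hd R}" using D RA by auto
  note j1 = simple_path_join[OF D(1) pR D(3) this]
  \<comment> \<open>If \<open>A\<close> and \<open>B\<close> share the vertex
    \<open>last A = hd B\<close>, then \<open>R\<close> is that single vertex, so the overlap is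
    still only \<open>hd F\<close>.\<close>
  have "set D \<inter> set F \<subseteq> {hd F}"
  proof
    fix x assume "x \<in> set D \<inter> set F"
    then have "x = last A" "x \<in> set B" using D F AB by auto
    then show "x \<in> {hd F}" using R RB pRD F by auto
  qed
  then have "set (D @ tl R) \<inter> set F \<subseteq> {hd F}" using F(2,4) RB j1(4) by auto
  note j2 = simple_path_join[OF j1(1) F(1) _ this]
  have S': "hd S \<noteq> last S"
  proof
    assume "hd S = last S"
    then have "hd S = last A" using SA(1) SB(1) AB by auto
    then show False using R dis pRD(5) pSD(5) by (metis disjoint_iff)
  qed
  have "set D \<inter> set S \<subseteq> {hd S}" "set F \<inter> set S \<subseteq> {last S}" using D F SA SB by auto
  then have "set ((D @ tl R) @ tl F) \<inter> set S \<subseteq> {hd S, last S}"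
    using dis j1(4) j2(4) F(2) j1(3) by auto
  then obtain c where "simple_cycle V E c" "set ((D @ tl R) @ tl F) \<subseteq> set c"
    using two_paths_cycle[OF \<open>sym E\<close> j2(1) pS] j2(2,3) j1(2,3) D(2) F(2,3) S' by metis
  then show ?thesis using j2(4) j1(3,4) F D by (intro exI[of _ c]) auto
qed

lemma linkage_cycle:
  assumes "sym E" "simple_path V E A" "simple_path V E B" "(hd A, last A) \<in> E" "(last B, hd B) \<in> E"
    "set A \<inter> set B \<subseteq> {last A} \<inter> {hd B}" and L: "linkage V E (set A) (last A) (set B) (hd B) R S"
  shows "\<exists>c. simple_cycle V E c \<and> insert (hd A) (E `` {hd A} \<inter> set A) \<subseteq> set c \<and>
    insert (last B) (E `` {last B} \<inter> set B) \<subseteq> set c"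
proof (cases "hd R = last A")
  case True
  show ?thesis by (rule linkage_cycle_aux[OF assms True])
next
  case False
  then have "hd S = last A" using L by (auto simp: linkage_def)
  then show ?thesis
    using linkage_cycle_aux[OF assms(1-6) L[unfolded linkage_commute[of _ _ _ _ _ _ R S]]] by blast
qed

section \<open>Long cycles from long paths\<close>

text \<open>Go along \<open>P\<close> to \<open>P ! i\<close>, jump to the last vertex, return to
  \<open>P ! j\<close> and jump to the first vertex. Only the positions strictly between
  \<open>i\<close> and \<open>j\<close> are left out.\<close>

lemma path_crossing_cycle:
  assumes "sym E" and P: "simple_path V E P"
    and ij: "i < j" "j < length P" "(last P, P ! i) \<in> E" "(hd P, P ! j) \<in> E"
  shows "\<exists>c. simple_cycle V E c \<and> length c = Suc i + (length P - j)"
proof -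
  let ?X = "take (Suc i) P" and ?Y = "drop j P"
  have ne: "?X \<noteq> []" "?Y \<noteq> []" using ij by auto
  have X: "simple_path V E ?X"
    using simple_path_appendD1[of V E ?X "drop (Suc i) P"] P ne by simp
  have Y: "simple_path V E ?Y"
    using simple_path_appendD2[of V E "take j P" ?Y] P ne by simp
  have "set ?X \<inter> set ?Y = {}"
    using P ij by (intro set_take_disj_set_drop_if_distinct) (auto simp: simple_path_def)
  moreover have lX: "last ?X = P ! i" using ij by (simp add: take_Suc_conv_app_nth)
  ultimately have "simple_path V E (?X @ rev ?Y)"
    using X Y ne ij \<open>sym E\<close>
    by (auto simp: simple_path_append_iff simple_path_rev hd_rev dest: symD)
  moreover have "hd ?Y = P ! j" using ij by (simp add: hd_drop_conv_nth)
  then have "(last (?X @ rev ?Y), hd (?X @ rev ?Y)) \<in> E"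
    using ne ij \<open>sym E\<close> by (auto simp: last_rev dest: symD)
  ultimately show ?thesis
    using ij by (intro exI[of _ "?X @ rev ?Y"]) (auto simp: simple_cycle_def)
qed

text \<open>If a neighbour of the last vertex precedes a neighbour of the first one, a closest such pair gives
  a cycle missing only vertices adjacent to neither end. Otherwise the first vertex sees only an
  initial segment and the last one only a final segment, and a linkage of the two segments closes up
  to a cycle through all neighbours of both ends.\<close>

lemma long_cycle_of_path:
  assumes sym: "sym E" and irr: "irrefl E" and nc: "no_cutvertex V E"
    and P: "simple_path V E P" and "3 \<le> length P" "k \<le> length P"
    and deg: "k \<le> card (E `` {hd P} \<inter> set P) + card (E `` {last P} \<inter> set P)"
  shows "\<exists>c. simple_cycle V E c \<and> k \<le> length c"
proof -
  define m where "m = length P"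
  define N1 where "N1 = {j. j < m \<and> (hd P, P ! j) \<in> E}"
  define N2 where "N2 = {i. i < m \<and> (last P, P ! i) \<in> E}"
  note D = simple_pathD[OF P]
  have inj: "inj_on ((!) P) {..<m}" using D(2) by (simp add: m_def inj_on_nth)
  have "(!) P ` N1 = E `` {hd P} \<inter> set P" "(!) P ` N2 = E `` {last P} \<inter> set P"
    by (auto simp: N1_def N2_def m_def in_set_conv_nth)
  then have card: "card (E `` {hd P} \<inter> set P) = card N1" "card (E `` {last P} \<inter> set P) = card N2"
    by (metis (no_types, lifting) card_image inj inj_on_subset lessThan_iff subsetI N1_def N2_def mem_Collect_eq)+
  have hdP: "hd P = P ! 0" and lastP: "last P = P ! (m - 1)"
    using D(1) by (auto simp: hd_conv_nth last_conv_nth m_def)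
  have N10: "0 \<notin> N1" and N2m: "m - 1 \<notin> N2"
    using irr by (auto simp: N1_def N2_def hdP lastP irrefl_def)
  have fin: "finite N1" "finite N2" by (auto simp: N1_def N2_def)
  show ?thesis
  proof (cases "\<exists>i j. i < j \<and> j \<in> N1 \<and> i \<in> N2")
    case True
    then obtain z where z: "fst z < snd z \<and> snd z \<in> N1 \<and> fst z \<in> N2" by auto
    obtain z where z: "fst z < snd z \<and> snd z \<in> N1 \<and> fst z \<in> N2"
      and zmin: "\<And>y. fst y < snd y \<and> snd y \<in> N1 \<and> fst y \<in> N2 \<Longrightarrow> snd z - fst z \<le> snd y - fst y"
      using ex_has_least_nat[of "\<lambda>z. fst z < snd z \<and> snd z \<in> N1 \<and> fst z \<in> N2" z "\<lambda>z. snd z - fst z", OF z]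
      by blast
    obtain i j where ij_eq: "z = (i, j)" by (cases z)
    have ij: "i < j" "j \<in> N1" "i \<in> N2"
      and min: "\<And>i' j'. i' < j' \<Longrightarrow> j' \<in> N1 \<Longrightarrow> i' \<in> N2 \<Longrightarrow> j - i \<le> j' - i'"
      using z zmin[of "(_, _)"] unfolding ij_eq by auto
    have jm: "j < m" using ij by (auto simp: N1_def)
    obtain c where c: "simple_cycle V E c" "length c = Suc i + (m - j)"
      using path_crossing_cycle[OF sym P, of i j] ij by (auto simp: N1_def N2_def m_def)
    show ?thesis
    proof (cases "j = Suc i")
      case True
      then show ?thesis using c jm \<open>k \<le> length P\<close> by (intro exI[of _ c]) (auto simp: m_def)
    next
      case False
      have gap: "l \<notin> N1" "l \<notin> N2" if "i < l" "l < j" for l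
        using min[of i l] min[of l j] ij that by auto
      \<comment> \<open>Such an \<open>l\<close> would be a crossing pair with gap 1, contradicting
        the minimality of \<open>j - i\<close>.\<close>
      have "Suc l \<in> N1 \<Longrightarrow> l \<in> N2 \<Longrightarrow> False" for l
        using min[of l "Suc l"] False ij(1) by auto
      then have disj: "N1 \<inter> Suc ` N2 = {}" by auto
      \<comment> \<open>The gap contains no neighbour position, and the shift moves
        \<open>N2\<close> by one, so both sets avoid \<open>{i + 2..<j}\<close>. The positions that
        remain are exactly as many as the cycle has vertices.\<close>
      have "N1 \<union> Suc ` N2 \<subseteq> {1..<m} - {i + 2..<j}"
      proof
        fix l assume "l \<in> N1 \<union> Suc ` N2"
        then consider "l \<in> N1" | l' where "l = Suc l'" "l' \<in> N2" by auto
        then show "l \<in> {1..<m} - {i + 2..<j}"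
        proof cases
          case 1
          then have "l < m" "l \<noteq> 0" using N10 by (auto simp: N1_def intro: gr0I)
          then show ?thesis using 1 gap[of l] by auto
        next
          case 2
          then have "l' < m" "l' \<noteq> m - 1" using N2m by (auto simp: N2_def)
          then show ?thesis using 2 gap[of l'] by auto
        qed
      qed
      then have "card (N1 \<union> Suc ` N2) \<le> card ({1..<m} - {i + 2..<j})"
        by (intro card_mono) auto
      also have "\<dots> = (m - 1) - (j - (i + 2))"
        using jm by (subst card_Diff_subset) auto
      also have "\<dots> = Suc i + (m - j)" using False ij(1) jm by simp
      finally have "card N1 + card N2 \<le> length c"
        using fin disj c by (simp add: card_Un_disjoint card_image)
      then show ?thesis using c deg card by auto
    qed
  next
    case False
    have e: "(P ! l, P ! Suc l) \<in> E" if "Suc l < m" for l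
      using D(4) that by (simp add: successively_conv_nth m_def)
    have m3: "3 \<le> m" using \<open>3 \<le> length P\<close> by (simp add: m_def)
    have "1 \<in> N1" using e[of 0] m3 by (simp add: N1_def hdP)
    moreover have "Suc (m - 2) = m - 1" using m3 by simp
    then have "m - 2 \<in> N2" using e[of "m - 2"] m3 sym by (auto simp: N2_def lastP dest: symD)
    ultimately have ne: "N1 \<noteq> {}" "N2 \<noteq> {}" by auto
    define p where "p = Max N1"
    define q where "q = Min N2"
    have p: "p \<in> N1" "\<And>l. l \<in> N1 \<Longrightarrow> l \<le> p" "1 \<le> p"
      using fin ne \<open>1 \<in> N1\<close> by (auto simp: p_def)
    have q: "q \<in> N2" "\<And>l. l \<in> N2 \<Longrightarrow> q \<le> l" "q \<le> m - 2"
      using fin ne \<open>m - 2 \<in> N2\<close> by (auto simp: q_def)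
    have pq: "p \<le> q" using False p(1) q(1) by (meson not_le_imp_less)
    have qm: "Suc q < m" using q(3) m3 by simp
    let ?A = "take (Suc p) P" and ?B = "drop q P"
    have neAB: "?A \<noteq> []" "?B \<noteq> []" using qm m3 by (auto simp: m_def)
    have A: "simple_path V E ?A"
      using simple_path_appendD1[of V E ?A "drop (Suc p) P"] P neAB by simp
    have B: "simple_path V E ?B"
      using simple_path_appendD2[of V E "take q P" ?B] P neAB by simp
    have "hd ?A = hd P" by simp
    moreover have "last ?A = P ! p" "hd ?B = P ! q" "last ?B = last P"
      using neAB qm pq by (auto simp: take_Suc_conv_app_nth hd_drop_conv_nth m_def)
    ultimately have ends: "hd ?A = hd P" "last ?A = P ! p" "hd ?B = P ! q" "last ?B = last P" .
    have AB: "set ?A \<inter> set ?B \<subseteq> {P ! p} \<inter> {P ! q}"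
    proof
      fix x assume x: "x \<in> set ?A \<inter> set ?B"
      obtain a where "a < length ?A" "x = ?A ! a"
        using x by (metis IntE in_set_conv_nth)
      then have a: "a \<le> p" "a < m" "x = P ! a" by (auto simp: m_def)
      obtain b where b: "b < length ?B" "x = ?B ! b"
        using x by (metis IntE in_set_conv_nth)
      then have "q + b < m" "x = P ! (q + b)" by (auto simp: m_def)
      then have "a = q + b" using inj a by (auto simp: inj_on_def)
      moreover from this have "p = q" "b = 0" using a pq by auto
      ultimately show "x \<in> {P ! p} \<inter> {P ! q}" using a by simp
    qed
    obtain R S where L: "linkage V E (set ?A) (P ! p) (set ?B) (P ! q) R S"
      using linkage_along_path[OF nc P, of p q] p pq qm by (auto simp: m_def)
    obtain c where c: "simple_cycle V E c"
      "insert (hd P) (E `` {hd P} \<inter> set ?A) \<subseteq> set c"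
      "insert (last P) (E `` {last P} \<inter> set ?B) \<subseteq> set c"
      using linkage_cycle[OF sym A B, unfolded ends, OF _ _ AB L] p(1) q(1)
      by (auto simp: N1_def N2_def)
    have "E `` {hd P} \<inter> set P \<subseteq> set ?A"
    proof
      fix x assume "x \<in> E `` {hd P} \<inter> set P"
      then obtain l where l: "l \<in> N1" "x = P ! l" by (auto simp: N1_def m_def in_set_conv_nth)
      then have "?A ! l = x" "l < length ?A" using p(2)[of l] by (auto simp: N1_def m_def)
      then show "x \<in> set ?A" using nth_mem by blast
    qed
    moreover have "E `` {last P} \<inter> set P \<subseteq> set ?B"
    proof
      fix x assume "x \<in> E `` {last P} \<inter> set P"
      then obtain l where l: "l \<in> N2" "x = P ! l" by (auto simp: N2_def m_def in_set_conv_nth)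
      then have "?B ! (l - q) = x" "l - q < length ?B" using q(2)[of l] by (auto simp: N2_def m_def)
      then show "x \<in> set ?B" using nth_mem by blast
    qed
    \<comment> \<open>Adding the ends themselves gains two vertices, which pays for
      \<open>P ! p\<close>, the only vertex the two sets can share.\<close>
    moreover define X where "X = insert (hd P) (E `` {hd P} \<inter> set P)"
    moreover define Y where "Y = insert (last P) (E `` {last P} \<inter> set P)"
    moreover have "hd P \<in> set ?A" "last P \<in> set ?B"
      using neAB ends hd_in_set last_in_set by metis+
    ultimately have XY: "X \<subseteq> set c" "Y \<subseteq> set c" "X \<subseteq> set ?A" "Y \<subseteq> set ?B"
      using c by auto
    have fXY: "finite X" "finite Y" by (auto simp: X_def Y_def)
    have "card X = Suc (card N1)" "card Y = Suc (card N2)"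
      using irr by (auto simp: X_def Y_def card irrefl_def)
    moreover have "card (X \<inter> Y) \<le> card {P ! p}"
      using XY AB by (intro card_mono) auto
    moreover have "card X + card Y = card (X \<union> Y) + card (X \<inter> Y)"
      using fXY by (rule card_Un_Int)
    moreover have "card (X \<union> Y) \<le> card (set c)"
      using XY by (intro card_mono) auto
    moreover have "card (set c) \<le> length c" by (rule card_length)
    ultimately have "card N1 + card N2 \<le> length c" by simp
    then show ?thesis using c deg card by auto
  qed
qed

section \<open>Counting complete bipartite subgraphs\<close>

text \<open>Ordered pairs of sides: a copy of \<open>K\<^bsub>s,s\<^esub>\<close> is counted twice.\<close>

definition bip_pairs :: "nat \<Rightarrow> nat \<Rightarrow> 'a rel \<Rightarrow> 'a set \<Rightarrow> ('a set \<times> 'a set) set" where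
  "bip_pairs s t E U = {(S, T). S \<subseteq> U \<and> T \<subseteq> U \<and> card S = s \<and> card T = t \<and> S \<times> T \<subseteq> E}"

text \<open>With \<open>w = k - a\<close> this is \<open>g\<close> (doubled for \<open>s = t\<close>) after telescoping its sum. The subtractions
  inside the binomials may truncate, which is harmless since \<open>0 choose t = 0\<close> for \<open>t \<ge> 1\<close>.\<close>

definition bip_bound :: "nat \<Rightarrow> nat \<Rightarrow> nat \<Rightarrow> nat \<Rightarrow> nat \<Rightarrow> real" where
  "bip_bound s t n w a =
     real (a choose s) * (real ((n - s) choose t) - real ((w - s) choose t)) +
     real (a choose t) * (real ((n - t) choose s) - real ((w - t) choose s)) +
     real (w choose (s + t)) * real ((s + t) choose s)"

lemma binomial_mono_left: "n \<le> N \<Longrightarrow> n choose k \<le> N choose k"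
proof (induction N rule: dec_induct)
  case (step N)
  have "N choose k \<le> Suc N choose k" by (cases k) auto
  then show ?case using step by linarith
qed simp

text \<open>Both sides count disjoint pairs of an \<open>s\<close>-set and a \<open>j\<close>-set in
  an \<open>m\<close>-set. When \<open>m\<close> is too small both vanish, despite the truncated
  subtraction.\<close>

lemma choose_mult_disjoint: "(m choose s) * ((m - s) choose j) = (m choose (s + j)) * ((s + j) choose s)"
proof (cases "s + j \<le> m")
  case True
  then show ?thesis using choose_mult[of s "s + j" m] by simp
next
  case False
  then have "m < s \<or> m - s < j" by linarith
  then have "(m choose s) * ((m - s) choose j) = 0" by (metis binomial_eq_0 mult_is_0)
  moreover have "m choose (s + j) = 0" using False by (simp add: binomial_eq_0)
  ultimately show ?thesis by (metis mult_0)
qed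

lemma finite_bip_pairs [simp]: "finite U \<Longrightarrow> finite (bip_pairs s t E U)"
  by (rule finite_subset[of _ "Pow U \<times> Pow U"]) (auto simp: bip_pairs_def)

lemma card_bip_pairs_mono:
  "finite U \<Longrightarrow> E \<subseteq> F \<Longrightarrow> card (bip_pairs s t E U) \<le> card (bip_pairs s t F U)"
  by (intro card_mono) (simp, auto simp: bip_pairs_def)

text \<open>With \<open>N = U\<close> this counts the pairs in a complete graph; with
  \<open>N\<close> a neighbourhood it counts those through a given vertex.\<close>

lemma card_disjoint_pairs:
  assumes "finite U" and "N \<subseteq> U"
  shows "card (SIGMA S:{S. S \<subseteq> N \<and> card S = s}. {T. T \<subseteq> U - S \<and> card T = t}) =
    (card N choose s) * ((card U - s) choose t)"
proof -
  have fN: "finite N" using assms by (auto intro: finite_subset)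
  have "card {T. T \<subseteq> U - S \<and> card T = t} = (card U - s) choose t"
    if "S \<in> {S. S \<subseteq> N \<and> card S = s}" for S
  proof -
    have "S \<subseteq> U" "finite S" using that \<open>N \<subseteq> U\<close> fN by (auto intro: finite_subset)
    then show ?thesis
      using n_subsets[of "U - S" t] that assms by (simp add: card_Diff_subset)
  qed
  then show ?thesis
    using fN assms n_subsets[OF fN, of s] by (subst card_SigmaI) auto
qed

lemma card_bip_pairs_le_complete:
  assumes "finite U" "irrefl E"
  shows "card (bip_pairs s t E U) \<le> (card U choose (s + t)) * ((s + t) choose s)"
proof -
  have "bip_pairs s t E U \<subseteq> (SIGMA S:{S. S \<subseteq> U \<and> card S = s}. {T. T \<subseteq> U - S \<and> card T = t})"
    using assms(2) by (auto simp: bip_pairs_def irrefl_def)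
  then have "card (bip_pairs s t E U) \<le>
      card (SIGMA S:{S. S \<subseteq> U \<and> card S = s}. {T. T \<subseteq> U - S \<and> card T = t})"
    using assms(1) by (intro card_mono finite_SigmaI) auto
  also have "\<dots> = (card U choose s) * ((card U - s) choose t)"
    using card_disjoint_pairs[OF assms(1) order.refl] .
  also have "\<dots> = (card U choose (s + t)) * ((s + t) choose s)"
    by (rule choose_mult_disjoint)
  finally show ?thesis .
qed

text \<open>All of \<open>S\<close> lies in the neighbourhood of \<open>v\<close>, and the other
  \<open>t - 1\<close> vertices of \<open>T\<close> are chosen off \<open>v\<close> and
  \<open>S\<close>.\<close>

lemma card_bip_pairs_through_vertex:
  assumes U: "finite U" "v \<in> U" and E: "sym E" "irrefl E" and "t \<ge> 1"
  shows "card {(S, T) \<in> bip_pairs s t E U. v \<in> T} \<le>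
    (card (E `` {v} \<inter> U) choose s) * ((card U - 1 - s) choose (t - 1))"
proof -
  let ?N = "E `` {v} \<inter> U"
  let ?Q = "SIGMA S:{S. S \<subseteq> ?N \<and> card S = s}. {T. T \<subseteq> (U - {v}) - S \<and> card T = t - 1}"
  have N: "?N \<subseteq> U - {v}" using E(2) by (auto simp: irrefl_def)
  have fT: "finite T" if "T \<subseteq> U" for T using that U(1) by (rule finite_subset)
  have "card {(S, T) \<in> bip_pairs s t E U. v \<in> T} \<le> card ?Q"
  proof (rule card_inj_on_le)
    show "inj_on (\<lambda>(S, T). (S, T - {v})) {(S, T) \<in> bip_pairs s t E U. v \<in> T}"
      by (auto simp: inj_on_def)
    show "(\<lambda>(S, T). (S, T - {v})) ` {(S, T) \<in> bip_pairs s t E U. v \<in> T} \<subseteq> ?Q"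
      using E fT by (auto simp: bip_pairs_def irrefl_def sym_def)
    show "finite ?Q" using U by (intro finite_SigmaI) auto
  qed
  also have "\<dots> = (card ?N choose s) * ((card U - 1 - s) choose (t - 1))"
    using card_disjoint_pairs[of "U - {v}" ?N s "t - 1"] U N by simp
  finally show ?thesis .
qed

lemma bip_pairs_swap: "sym E \<Longrightarrow> (T, S) \<in> bip_pairs t s E U \<longleftrightarrow> (S, T) \<in> bip_pairs s t E U"
  by (auto simp: bip_pairs_def sym_def)

text \<open>Pascal's rule turns the number of pairs through a vertex into a difference that
  telescopes over successive deletions.\<close>

lemma binomial_step_bound:
  assumes "d < u" "d \<le> a" "t \<ge> 1"
  shows "real ((d choose s) * ((u - 1 - s) choose (t - 1))) \<le>
    real (a choose s) * (real ((u - s) choose t) - real ((u - 1 - s) choose t))"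
proof (cases "s \<le> u - 1")
  case True
  then have "u - s = Suc (u - 1 - s)" "t = Suc (t - 1)" using assms by auto
  then have "(u - s) choose t = ((u - 1 - s) choose (t - 1)) + ((u - 1 - s) choose t)"
    by (metis binomial_Suc_Suc)
  moreover have "d choose s \<le> a choose s" using assms(2) by (rule binomial_mono_left)
  ultimately show ?thesis by (simp add: mult_right_mono)
next
  \<comment> \<open>Here the degree \<open>d\<close> is below \<open>s\<close>, so the left-hand
    side is zero.\<close>
  case False
  then have "d < s" "u - s = 0" "u - 1 - s = 0" using \<open>d < u\<close> by auto
  then show ?thesis by (simp add: binomial_eq_0)
qed

lemma card_bip_pairs_remove_vertex:
  assumes U: "finite U" "v \<in> U" and E: "sym E" "irrefl E" and st: "s \<ge> 1" "t \<ge> 1"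
    and deg: "card (E `` {v} \<inter> U) \<le> a"
  shows "real (card (bip_pairs s t E U)) \<le> real (card (bip_pairs s t E (U - {v}))) +
    real (a choose s) * (real ((card U - s) choose t) - real ((card U - 1 - s) choose t)) +
    real (a choose t) * (real ((card U - t) choose s) - real ((card U - 1 - t) choose s))"
proof -
  let ?d = "card (E `` {v} \<inter> U)"
  let ?X = "{(S, T) \<in> bip_pairs s t E U. v \<in> T}" and ?Y = "{(S, T) \<in> bip_pairs t s E U. v \<in> T}"
  \<comment> \<open>A pair that is lost has \<open>v\<close> in \<open>T\<close> or in
    \<open>S\<close>. The second kind becomes the first with \<open>s\<close> and \<open>t\<close>
    exchanged.\<close>
  have "bip_pairs s t E U \<subseteq> bip_pairs s t E (U - {v}) \<union> ?X \<union> prod.swap ` ?Y"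
  proof
    fix z assume z: "z \<in> bip_pairs s t E U"
    obtain S T where "z = (S, T)" by (cases z)
    moreover from this have "prod.swap z \<in> ?Y" if "v \<in> S"
      using z that bip_pairs_swap[OF E(1)] by auto
    then have "z \<in> prod.swap ` ?Y" if "v \<in> S"
      using that by (metis (no_types, lifting) imageI swap_swap)
    ultimately show "z \<in> bip_pairs s t E (U - {v}) \<union> ?X \<union> prod.swap ` ?Y"
      using z by (auto simp: bip_pairs_def)
  qed
  moreover have fin: "finite ?X" "finite ?Y"
    using U by (auto intro: finite_subset[of _ "bip_pairs s t E U"] finite_subset[of _ "bip_pairs t s E U"])
  ultimately have "card (bip_pairs s t E U) \<le> card (bip_pairs s t E (U - {v}) \<union> ?X \<union> prod.swap ` ?Y)"
    using U by (intro card_mono) auto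
  also have "\<dots> \<le> card (bip_pairs s t E (U - {v})) + card ?X + card ?Y"
    using card_Un_le[of "bip_pairs s t E (U - {v}) \<union> ?X" "prod.swap ` ?Y"]
      card_Un_le[of "bip_pairs s t E (U - {v})" ?X] card_image_le[OF fin(2), of prod.swap]
    by linarith
  finally have *: "real (card (bip_pairs s t E U)) \<le>
    real (card (bip_pairs s t E (U - {v}))) + real (card ?X) + real (card ?Y)" by linarith
  have "E `` {v} \<inter> U \<subset> U" using U E by (auto simp: irrefl_def)
  then have d: "?d < card U" using U by (intro psubset_card_mono)
  have "real (card ?X) \<le> real (a choose s) * (real ((card U - s) choose t) - real ((card U - 1 - s) choose t))"
    using card_bip_pairs_through_vertex[OF U E st(2), of s] binomial_step_bound[OF d deg st(2), of s]
    by linarith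
  moreover have "real (card ?Y) \<le> real (a choose t) * (real ((card U - t) choose s) - real ((card U - 1 - t) choose s))"
    using card_bip_pairs_through_vertex[OF U E st(1), of t] binomial_step_bound[OF d deg st(1), of t]
    by linarith
  ultimately show ?thesis using * by linarith
qed

text \<open>Delete low-degree vertices outside \<open>W\<close> until \<open>w\<close> vertices
  remain. The losses telescope, and the remainder is bounded by a complete graph on \<open>w\<close>
  vertices.\<close>

lemma card_bip_pairs_degenerate:
  assumes "finite U" "sym E" "irrefl E" "s \<ge> 1" "t \<ge> 1"
    and "W \<subseteq> U" "card W \<le> w" "w \<le> card U"
    and "\<And>X. W \<subset> X \<Longrightarrow> X \<subseteq> U \<Longrightarrow> \<exists>v\<in>X - W. card (E `` {v} \<inter> X) \<le> a"
  shows "real (card (bip_pairs s t E U)) \<le> bip_bound s t (card U) w a"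
  using assms
proof (induction "card U" arbitrary: U rule: less_induct)
  case less
  show ?case
  proof (cases "card U = w")
    case True
    then show ?thesis
      using card_bip_pairs_le_complete[OF less.prems(1,3), of s t]
      by (simp add: bip_bound_def flip: of_nat_mult)
  next
    case False
    then have "W \<noteq> U" using less.prems by auto
    with less.prems obtain v where v: "v \<in> U - W" "card (E `` {v} \<inter> U) \<le> a" by blast
    have c: "card (U - {v}) = card U - 1" "card U - 1 < card U" "w \<le> card U - 1"
      using v less.prems False by (auto simp: card_gt_0_iff)
    have "real (card (bip_pairs s t E (U - {v}))) \<le> bip_bound s t (card (U - {v})) w a"
      using less.prems v c by (intro less.hyps) auto
    then show ?thesis
      using card_bip_pairs_remove_vertex[of U v E s t a] less.prems v c
      by (simp add: bip_bound_def algebra_simps)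
  qed
qed

section \<open>Closed form of the function g\<close>

lemma int_binom_diff: "t \<ge> 1 \<Longrightarrow> int_binom (int n - int s) t = real ((n - s) choose t)"
  by (auto simp: int_binom_def nat_diff_distrib)

text \<open>Pascal's rule survives the cut-off at negative entries: at \<open>x = -1\<close> the
  left-hand side is \<open>0 choose Suc j\<close>, which is 0.\<close>

lemma int_binom_Suc: "int_binom (x + 1) (Suc j) = int_binom x j + int_binom x (Suc j)"
proof (cases "x \<ge> 0")
  case True
  then have "nat (x + 1) = Suc (nat x)" by simp
  then show ?thesis using True by (simp add: int_binom_def)
qed (simp add: int_binom_def)

lemma sum_int_binom:
  "(\<Sum>i = 1..int m. int_binom (x - i) j) = int_binom x (Suc j) - int_binom (x - int m) (Suc j)"
proof (induction m)
  case (Suc m)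
  have "{1..int (Suc m)} = insert (int (Suc m)) {1..int m}" by auto
  then show ?case
    using Suc int_binom_Suc[of "x - int (Suc m)" j] by simp
qed simp

text \<open>For \<open>s = t\<close> the two products in \<open>bip_bound\<close> coincide while
  \<open>g\<close> has only one of them and half the last term, hence the factor 2.\<close>

lemma g_eq_bip_bound:
  assumes "s \<ge> 1" "t \<ge> 1" "a \<le> k" "k \<le> n"
  shows "(if s = t then 2 else 1) * g s t (int n) (int k) (int a) = bip_bound s t n (k - a) a"
proof -
  \<comment> \<open>The number of deletions that leave \<open>k - a\<close> of the \<open>n\<close>
    vertices.\<close>
  define m where "m = n - k + a"
  have m: "int n - int k + int a = int m" using assms by (simp add: m_def)
  have sum: "(\<Sum>i = 1..int m. int_binom (int a) s * int_binom (int n - int s - i) (t - 1)) =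
      real (a choose s) * (real ((n - s) choose t) - real ((k - a - s) choose t))"
    if "t \<ge> 1" for s t
  proof -
    have "int n - int s - int m = int (k - a) - int s" using assms by (simp add: m_def)
    then have "int_binom (int n - int s - int m) t = real ((k - a - s) choose t)"
      using that by (metis int_binom_diff)
    then have "(\<Sum>i = 1..int m. int_binom (int n - int s - i) (t - 1)) =
        real ((n - s) choose t) - real ((k - a - s) choose t)"
      using sum_int_binom[of "int n - int s" "t - 1" m] that by (simp add: int_binom_diff)
    then show ?thesis by (simp add: int_binom_def flip: sum_distrib_left)
  qed
  have ka: "int_binom (int k - int a) j = real ((k - a) choose j)" for j
    using assms by (simp add: int_binom_def nat_diff_distrib)
  show ?thesis
  proof (cases "s = t")
    case True
    show ?thesis
      unfolding g_def m bip_bound_def True ka sum[OF assms(2)] mult_2[of t] by simp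
  next
    case False
    then show ?thesis
      unfolding g_def m bip_bound_def ka sum.distrib sum[OF assms(2)] sum[OF assms(1)] by simp
  qed
qed

section \<open>Convexity of the bound\<close>

lemma binomial_second_difference:
  assumes "t \<ge> 2"
  shows "real (Suc (Suc x) choose t) - 2 * real (Suc x choose t) + real (x choose t) = real (x choose (t - 2))"
proof -
  obtain j where "t = Suc (Suc j)" using assms by (metis Suc_diff_Suc le_add_diff_inverse numeral_2_eq_2 add_2_eq_Suc)
  then show ?thesis by simp
qed

text \<open>The factor \<open>K - S\<close> is concave, and its second difference is the only negative contribution;
  \<open>m\<close> plays the role of \<open>k - a - 2\<close>.\<close>

lemma product_second_difference:
  fixes s t n m a :: nat
  assumes "t \<ge> 1" "n \<ge> m + 2" "a < m"
  defines "F \<equiv> \<lambda>x. real (x choose s)" and "K \<equiv> real ((n - s) choose t)"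
    and "S \<equiv> \<lambda>x. real ((x - s) choose t)"
  shows "F (a + 2) * (K - S m) - 2 * (F (a + 1) * (K - S (m + 1))) + F a * (K - S (m + 2)) \<ge>
    - (if t \<ge> 2 then real (m choose s) * real ((m - s) choose (t - 2)) else 0)"
proof -
  have S_mono: "S x \<le> S y" if "x \<le> y" for x y
    using that unfolding S_def by (simp add: binomial_mono_left)
  have "S (m + 2) \<le> K"
    using assms(2) unfolding S_def K_def by (simp add: binomial_mono_left)
  have F_diff: "0 \<le> F (a + 1) - F a" "F (a + 1) - F a \<le> F (a + 2) - F (a + 1)"
  proof -
    show "0 \<le> F (a + 1) - F a" by (simp add: F_def binomial_mono_left)
    show "F (a + 1) - F a \<le> F (a + 2) - F (a + 1)"
    proof (cases s)
      case (Suc j)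
      have "a choose j \<le> Suc a choose j" by (simp add: binomial_mono_left)
      then show ?thesis using Suc by (simp add: F_def)
    qed (simp add: F_def)
  qed
  have "F (a + 2) * (K - S m) - 2 * (F (a + 1) * (K - S (m + 1))) + F a * (K - S (m + 2)) =
      (F (a + 2) - F (a + 1)) * (K - S m) - (F (a + 1) - F a) * (K - S (m + 2)) -
      F (a + 1) * (S (m + 2) - 2 * S (m + 1) + S m)"
    by algebra
  \<comment> \<open>The increments of \<open>F\<close> grow and \<open>K - S\<close> decreases, so
    the first two terms of the regrouped expression contribute a nonnegative amount.\<close>
  moreover have "(F (a + 1) - F a) * (K - S (m + 2)) \<le> (F (a + 2) - F (a + 1)) * (K - S m)"
    using F_diff S_mono[of m "m + 2"] \<open>S (m + 2) \<le> K\<close> by (intro mult_mono) auto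
  moreover have "F (a + 1) * (S (m + 2) - 2 * S (m + 1) + S m) \<le>
      (if t \<ge> 2 then real (m choose s) * real ((m - s) choose (t - 2)) else 0)"
  proof (cases "s \<le> m")
    case True
    then have S: "S (m + 2) = real (Suc (Suc (m - s)) choose t)" "S (m + 1) = real (Suc (m - s) choose t)"
      by (simp_all add: S_def Suc_diff_le)
    have "F (a + 1) \<le> real (m choose s)" using \<open>a < m\<close> by (simp add: F_def binomial_mono_left)
    show ?thesis
    proof (cases "t \<ge> 2")
      case True
      then have "S (m + 2) - 2 * S (m + 1) + S m = real ((m - s) choose (t - 2))"
        unfolding S using binomial_second_difference[OF True, of "m - s"] by (simp add: S_def)
      then show ?thesis using True \<open>F (a + 1) \<le> real (m choose s)\<close> by (simp add: mult_right_mono)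
    next
      case False
      then have "t = 1" using \<open>t \<ge> 1\<close> by simp
      then show ?thesis unfolding S by (simp add: S_def)
    qed
  next
    \<comment> \<open>Now \<open>a + 1 \<le> m < s\<close>, so the factor \<open>F (a + 1)\<close>
      removes the term with truncated subtraction.\<close>
    case False
    then have "F (a + 1) = 0" using \<open>a < m\<close> by (simp add: F_def)
    then show ?thesis by simp
  qed
  ultimately show ?thesis by linarith
qed

text \<open>Two applications of Pascal's rule split the right-hand side into terms with weights 1,
  2, 1. The outer two are the left-hand side, after using symmetry for one of them.\<close>

lemma binomial_Pascal_twice:
  assumes "s \<ge> 1" "t \<ge> 1" "s + t \<ge> 2"
  shows "(if t \<ge> 2 then (s + t - 2) choose s else 0) + (if s \<ge> 2 then (s + t - 2) choose t else 0) \<le>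
    (s + t) choose s"
proof -
  obtain p q where st: "s = Suc p" "t = Suc q" using assms by (metis Suc_diff_1 less_eq_Suc_le One_nat_def)
  have "(p + q) choose Suc q = (p + q) choose (p - 1)" if "p \<ge> 1"
    using that binomial_symmetric[of "Suc q" "p + q"] by simp
  moreover have "Suc (Suc (p + q)) choose Suc p =
     ((p + q) choose Suc p) + 2 * ((p + q) choose p) + (if p \<ge> 1 then (p + q) choose (p - 1) else 0)"
    by (cases p) auto
  ultimately show ?thesis using st by auto
qed

text \<open>The second difference of the complete-graph term outweighs the possible losses of the
  two products, since all are multiples of \<open>m choose (s + t - 2)\<close>. The condition on
  \<open>k\<close> says \<open>a + 2 \<le> (k - 1) div 2\<close>.\<close>

lemma bip_bound_convex:
  assumes st: "s \<ge> 1" "t \<ge> 1" and "n \<ge> k" and "2 * a + 5 \<le> k"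
  shows "2 * bip_bound s t n (k - (a + 1)) (a + 1) \<le>
    bip_bound s t n (k - a) a + bip_bound s t n (k - (a + 2)) (a + 2)"
proof -
  define m where "m = k - a - 2"
  have m: "k - a = m + 2" "k - (a + 1) = m + 1" "k - (a + 2) = m" "n \<ge> m + 2" "a < m"
    using assms by (auto simp: m_def)
  let ?c = "real ((s + t) choose s)"
  have P1: "(if t \<ge> 2 then real (m choose s) * real ((m - s) choose (t - 2)) else 0) =
     real (m choose (s + t - 2)) * real (if t \<ge> 2 then (s + t - 2) choose s else 0)"
    using choose_mult_disjoint[of m s "t - 2"] by (auto simp flip: of_nat_mult)
  have P2: "(if s \<ge> 2 then real (m choose t) * real ((m - t) choose (s - 2)) else 0) =
     real (m choose (s + t - 2)) * real (if s \<ge> 2 then (s + t - 2) choose t else 0)"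
    using choose_mult_disjoint[of m t "s - 2"] by (auto simp: add.commute simp flip: of_nat_mult)
  have "real (m choose (s + t - 2)) * real (if t \<ge> 2 then (s + t - 2) choose s else 0) +
      real (m choose (s + t - 2)) * real (if s \<ge> 2 then (s + t - 2) choose t else 0) \<le>
      real (m choose (s + t - 2)) * ?c"
    using binomial_Pascal_twice[OF st] st
    by (auto simp flip: distrib_left of_nat_add intro!: mult_left_mono)
  moreover have "real (m + 2 choose (s + t)) * ?c - 2 * (real (m + 1 choose (s + t)) * ?c) + real (m choose (s + t)) * ?c =
     real (m choose (s + t - 2)) * ?c"
    using binomial_second_difference[of "s + t" m] st by (simp flip: left_diff_distrib distrib_right mult.assoc)
  moreover note product_second_difference[OF st(2) m(4,5), of s, unfolded P1]
    product_second_difference[OF st(1) m(4,5), of t, unfolded P2]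
  ultimately show ?thesis
    unfolding m bip_bound_def by argo
qed

lemma convex_seq_le_max:
  fixes f :: "nat \<Rightarrow> real"
  assumes "r \<le> a" "a \<le> h" and "\<And>b. r \<le> b \<Longrightarrow> b + 2 \<le> h \<Longrightarrow> 2 * f (b + 1) \<le> f b + f (b + 2)"
  shows "f a \<le> max (f r) (f h)"
  using assms
proof (induction h arbitrary: a)
  case (Suc h)
  show ?case
  proof (cases "a = Suc h \<or> h = r \<or> a = r")
    case True
    then show ?thesis using Suc.prems by (auto simp: le_Suc_eq)
  next
    case False
    then have "a \<le> h" "r < h" using Suc.prems by auto
    have IH: "f b \<le> max (f r) (f h)" if "r \<le> b" "b \<le> h" for b
      using that Suc.prems(3) by (intro Suc.IH) auto
    \<comment> \<open>Convexity bounds \<open>f h\<close> by its two neighbours. As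
      \<open>f (h - 1)\<close> is at most \<open>f r\<close> or \<open>f h\<close>, the value
      \<open>f h\<close> is at most \<open>f r\<close> or \<open>f (Suc h)\<close>.\<close>
    have "2 * f h \<le> f (h - 1) + f (Suc h)"
      using Suc.prems(3)[of "h - 1"] \<open>r < h\<close> by (simp add: numeral_2_eq_2)
    moreover have "f (h - 1) \<le> f r \<or> f (h - 1) \<le> f h"
      using IH[of "h - 1"] \<open>r < h\<close> by (simp add: le_max_iff_disj)
    ultimately have "f h \<le> f r \<or> f h \<le> f (Suc h)" by linarith
    moreover have "f a \<le> f r \<or> f a \<le> f h"
      using IH[of a] Suc.prems(1) \<open>a \<le> h\<close> by (simp add: le_max_iff_disj)
    ultimately show ?thesis by (auto simp: le_max_iff_disj)
  qed
qed simp

section \<open>Edge-maximal graphs without long cycles\<close>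

lemma simple_cycle_rotate:
  assumes "simple_cycle V E (xs @ ys)" "xs \<noteq> []" "ys \<noteq> []"
  shows "simple_cycle V E (ys @ xs)"
  using assms by (auto simp: simple_cycle_def simple_path_append_iff)

lemma path_of_new_closing_edge:
  assumes c: "simple_cycle V (E \<union> {(u, v), (v, u)}) c" and "3 \<le> length c"
    and "(last c, hd c) \<notin> E" and "sym E"
  shows "\<exists>P. simple_path V E P \<and> hd P = u \<and> last P = v \<and> length P = length c"
proof -
  let ?m = "length c"
  have path: "simple_path V (E \<union> {(u, v), (v, u)}) c" and ends: "{hd c, last c} = {u, v}"
    using c \<open>(last c, hd c) \<notin> E\<close> by (auto simp: simple_cycle_def)
  note D = simple_pathD[OF path]
  have e01: "hd c = c ! 0" "last c = c ! (?m - 1)"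
    using D(1) by (auto simp: hd_conv_nth last_conv_nth)
  have "(c ! i, c ! Suc i) \<in> E" if "Suc i < ?m" for i
  proof (rule ccontr)
    \<comment> \<open>A step outside \<open>E\<close> would again join \<open>u\<close> and
      \<open>v\<close>, the two ends of \<open>c\<close>, but in a list of length at least 3 the
      ends are not consecutive.\<close>
    assume "(c ! i, c ! Suc i) \<notin> E"
    moreover have "(c ! i, c ! Suc i) \<in> E \<union> {(u, v), (v, u)}"
      using D(4) that by (simp add: successively_conv_nth)
    ultimately have "{c ! i, c ! Suc i} = {c ! 0, c ! (?m - 1)}"
      using ends e01 by auto
    then have "c ! i = c ! 0 \<and> c ! Suc i = c ! (?m - 1) \<or> c ! Suc i = c ! 0"
      by (metis doubleton_eq_iff)
    moreover have "c ! l = c ! l' \<longleftrightarrow> l = l'" if "l < ?m" "l' < ?m" for l l'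
      using nth_eq_iff_index_eq[OF D(2)] that by blast
    moreover have "i < ?m" "0 < ?m" "?m - 1 < ?m" using that by auto
    ultimately have "i = 0 \<and> Suc i = ?m - 1 \<or> Suc i = 0" using that by metis
    then show False using \<open>3 \<le> length c\<close> by linarith
  qed
  then have P: "simple_path V E c"
    using D by (auto simp: simple_path_def successively_conv_nth)
  show ?thesis
  proof (cases "hd c = u")
    case True
    then have "last c = v" using ends by (auto simp: doubleton_eq_iff)
    then show ?thesis using P True by blast
  next
    case False
    then have "last c = u" "hd c = v" using ends by (auto simp: doubleton_eq_iff)
    then show ?thesis
      using P simple_path_rev[OF \<open>sym E\<close>, of V c] by (intro exI[of _ "rev c"]) (auto simp: hd_rev last_rev)
  qed
qed

text \<open>Rotate the cycle so that the new edge becomes the closing one.\<close>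

lemma path_of_new_edge_cycle:
  assumes c: "simple_cycle V (E \<union> {(u, v), (v, u)}) c" and "3 \<le> length c"
    and "\<not> simple_cycle V E c" and "sym E"
  shows "\<exists>P. simple_path V E P \<and> hd P = u \<and> last P = v \<and> length P = length c"
proof (cases "(last c, hd c) \<in> E")
  case False
  then show ?thesis by (rule path_of_new_closing_edge[OF assms(1,2) _ assms(4)])
next
  case True
  then have "\<not> successively (\<lambda>x y. (x, y) \<in> E) c"
    using assms by (auto simp: simple_cycle_def simple_path_def)
  then obtain i where i: "Suc i < length c" "(c ! i, c ! Suc i) \<notin> E"
    by (auto simp: successively_conv_nth)
  let ?d = "drop (Suc i) c @ take (Suc i) c"
  have "simple_cycle V (E \<union> {(u, v), (v, u)}) ?d"
    using simple_cycle_rotate[of V "E \<union> {(u, v), (v, u)}" "take (Suc i) c" "drop (Suc i) c"] c i(1)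
    by force
  moreover have "last ?d = c ! i" "hd ?d = c ! Suc i"
    using i by (auto simp: take_Suc_conv_app_nth hd_drop_conv_nth)
  moreover have "length ?d = length c" by simp
  ultimately show ?thesis
    using path_of_new_closing_edge[of V E u v ?d] i(2) assms(2,4) by metis
qed

text \<open>Take a maximal member of the finite family of admissible supersets of \<open>E\<close>.
  Adding a missing edge creates a cycle of length at least \<open>k\<close> through it, which
  becomes the required path when the edge is removed.\<close>

lemma edge_maximal_extension:
  assumes "finite V" "E \<subseteq> V \<times> V" "sym E" "irrefl E" "3 \<le> k"
    and "\<And>c. simple_cycle V E c \<Longrightarrow> length c < k"
  obtains F where "E \<subseteq> F" "F \<subseteq> V \<times> V" "sym F" "irrefl F"
    "\<And>c. simple_cycle V F c \<Longrightarrow> length c < k"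
    "\<And>u v. u \<in> V \<Longrightarrow> v \<in> V \<Longrightarrow> u \<noteq> v \<Longrightarrow> (u, v) \<notin> F \<Longrightarrow>
      \<exists>P. simple_path V F P \<and> hd P = u \<and> last P = v \<and> k \<le> length P"
proof -
  define \<F> where "\<F> = {F. E \<subseteq> F \<and> F \<subseteq> V \<times> V \<and> sym F \<and> irrefl F \<and> (\<forall>c. simple_cycle V F c \<longrightarrow> length c < k)}"
  have "finite \<F>"
    using assms(1) by (intro finite_subset[of \<F> "Pow (V \<times> V)"]) (auto simp: \<F>_def)
  moreover have "E \<in> \<F>" using assms by (auto simp: \<F>_def)
  ultimately obtain F where F: "F \<in> \<F>" and max: "\<And>F'. F' \<in> \<F> \<Longrightarrow> F \<subseteq> F' \<Longrightarrow> F = F'"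
    using finite_has_maximal[of \<F>] by blast
  have FD: "E \<subseteq> F" "F \<subseteq> V \<times> V" "sym F" "irrefl F" "\<And>c. simple_cycle V F c \<Longrightarrow> length c < k"
    using F by (auto simp: \<F>_def)
  have "\<exists>P. simple_path V F P \<and> hd P = u \<and> last P = v \<and> k \<le> length P"
    if uv: "u \<in> V" "v \<in> V" "u \<noteq> v" "(u, v) \<notin> F" for u v
  proof -
    let ?F = "F \<union> {(u, v), (v, u)}"
    have "?F \<notin> \<F>" using max[of ?F] uv(4) by auto
    moreover have "sym ?F" "irrefl ?F"
      using FD uv(3) by (auto simp: sym_def irrefl_def)
    ultimately obtain c where c: "simple_cycle V ?F c" "k \<le> length c"
      using FD uv unfolding \<F>_def by (auto simp: not_less)
    then show ?thesis
      using path_of_new_edge_cycle[OF c(1) _ _ FD(3)] FD(5)[of c] \<open>3 \<le> k\<close> by force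
  qed
  then show ?thesis using that[OF FD] by blast
qed

lemma no_cutvertex_mono: "no_cutvertex V E \<Longrightarrow> E \<subseteq> F \<Longrightarrow> no_cutvertex V F"
  unfolding no_cutvertex_def using simple_path_mono by metis

section \<open>Cores\<close>

text \<open>Kopylov's \<open>(a + 1)\<close>-core: what remains after deleting vertices of degree at most \<open>a\<close> as long as
  there are any.\<close>

definition core :: "'a set \<Rightarrow> 'a rel \<Rightarrow> nat \<Rightarrow> 'a set" where
  "core V E a = \<Union> {X. X \<subseteq> V \<and> (\<forall>v\<in>X. a < card (E `` {v} \<inter> X))}"

lemma core_subset: "core V E a \<subseteq> V"
  by (auto simp: core_def)

lemma core_greatest:
  "X \<subseteq> V \<Longrightarrow> (\<And>v. v \<in> X \<Longrightarrow> a < card (E `` {v} \<inter> X)) \<Longrightarrow> X \<subseteq> core V E a"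
  by (auto simp: core_def)

lemma card_nbhd_mono:
  "finite V \<Longrightarrow> X \<subseteq> Y \<Longrightarrow> Y \<subseteq> V \<Longrightarrow> card (E `` {v} \<inter> X) \<le> card (E `` {v} \<inter> Y)"
  by (intro card_mono) (auto intro: finite_subset)

text \<open>The union of the sets defining the core has their property too, since degrees only grow
  when the set is enlarged.\<close>

lemma core_degree:
  assumes "finite V" "v \<in> core V E a"
  shows "a < card (E `` {v} \<inter> core V E a)"
proof -
  obtain X where X: "v \<in> X" "X \<subseteq> V" "\<forall>v\<in>X. a < card (E `` {v} \<inter> X)"
    using assms(2) by (auto simp: core_def)
  then have "card (E `` {v} \<inter> X) \<le> card (E `` {v} \<inter> core V E a)"
    using assms(1) by (intro card_nbhd_mono[of V] core_greatest core_subset) auto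
  then show ?thesis using X by fastforce
qed

lemma core_antimono: "finite V \<Longrightarrow> a \<le> b \<Longrightarrow> core V E b \<subseteq> core V E a"
  by (intro core_greatest core_subset) (auto dest: core_degree)

text \<open>Otherwise \<open>X\<close> would itself be one of the sets whose union is the core. This
  supplies the deletion order for \<open>card_bip_pairs_degenerate\<close>.\<close>

lemma outside_core_low_degree:
  assumes "finite V" and W: "core V E a \<subset> X" "X \<subseteq> V"
  shows "\<exists>v\<in>X - core V E a. card (E `` {v} \<inter> X) \<le> a"
proof (rule ccontr)
  assume *: "\<not> ?thesis"
  have "a < card (E `` {v} \<inter> X)" if "v \<in> X" for v
  proof (cases "v \<in> core V E a")
    case True
    have "card (E `` {v} \<inter> core V E a) \<le> card (E `` {v} \<inter> X)"
      using assms by (intro card_nbhd_mono[of V]) auto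
    then show ?thesis using core_degree[OF assms(1) True] by linarith
  next
    case False
    then show ?thesis using * that by (meson DiffI not_le)
  qed
  then have "X \<subseteq> core V E a" using W by (intro core_greatest)
  then show False using W by auto
qed

section \<open>Longest paths and the bound for edge-maximal graphs\<close>

lemma longest_path_between:
  assumes "finite V" "sym E" and sub: "X \<subseteq> V" "Y \<subseteq> V"
    and P0: "simple_path V E P0" "hd P0 \<in> X" "last P0 \<in> Y"
  obtains P where "simple_path V E P" "hd P \<in> X" "last P \<in> Y" "length P0 \<le> length P"
    "E `` {hd P} \<inter> X \<subseteq> set P" "E `` {last P} \<inter> Y \<subseteq> set P"
proof -
  define Q where "Q P \<longleftrightarrow> simple_path V E P \<and> hd P \<in> X \<and> last P \<in> Y" for P
  have len: "length P \<le> card V" if "Q P" for P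
    using that card_mono[OF \<open>finite V\<close>, of "set P"] distinct_card[of P]
    by (auto simp: Q_def simple_path_def)
  obtain P where P: "Q P" and max: "\<And>P'. Q P' \<Longrightarrow> length P' \<le> length P"
    using ex_has_greatest_nat[of Q P0 length "Suc (card V)"] len P0 by (auto simp: Q_def less_Suc_eq_le)
  have path: "simple_path V E P" and ends: "hd P \<in> X" "last P \<in> Y" using P by (auto simp: Q_def)
  note D = simple_pathD[OF path]
  have "x \<in> set P" if "(hd P, x) \<in> E" "x \<in> X" for x
  proof (rule ccontr)
    assume "x \<notin> set P"
    then have "simple_path V E ([x] @ P)"
      using that D path sub \<open>sym E\<close> by (subst simple_path_append_iff) (auto simp: simple_path_def dest: symD)
    then have "Q (x # P)" using that ends D(1) by (simp add: Q_def)
    then show False using max by fastforce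
  qed
  moreover have "y \<in> set P" if "(last P, y) \<in> E" "y \<in> Y" for y
  proof (rule ccontr)
    assume "y \<notin> set P"
    then have "simple_path V E (P @ [y])"
      using that path sub by (intro simple_path_snoc) auto
    then have "Q (P @ [y])" using that ends D(1) by (simp add: Q_def)
    then show False using max by fastforce
  qed
  ultimately show ?thesis
    using that[OF path ends] max[of P0] P0 by (auto simp: Q_def)
qed

text \<open>On a longest path from \<open>X\<close> to \<open>Y\<close> all neighbours of its ends
  within \<open>X\<close> and \<open>Y\<close> lie on the path, so \<open>long_cycle_of_path\<close>
  applies.\<close>

lemma long_path_between_dense_sets:
  assumes "finite V" "sym E" "irrefl E" "no_cutvertex V E" and sub: "X \<subseteq> V" "Y \<subseteq> V" and "3 \<le> k"
    and X: "\<And>x. x \<in> X \<Longrightarrow> d \<le> card (E `` {x} \<inter> X)"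
    and Y: "\<And>y. y \<in> Y \<Longrightarrow> e \<le> card (E `` {y} \<inter> Y)" and "k \<le> d + e"
    and P: "simple_path V E P" "hd P \<in> X" "last P \<in> Y" "k \<le> length P"
  shows "\<exists>c. simple_cycle V E c \<and> k \<le> length c"
proof -
  obtain Q where Q: "simple_path V E Q" "hd Q \<in> X" "last Q \<in> Y" "length P \<le> length Q"
    "E `` {hd Q} \<inter> X \<subseteq> set Q" "E `` {last Q} \<inter> Y \<subseteq> set Q"
    using longest_path_between[OF assms(1,2) sub P(1-3)] by blast
  have "card (E `` {hd Q} \<inter> X) \<le> card (E `` {hd Q} \<inter> set Q)"
    "card (E `` {last Q} \<inter> Y) \<le> card (E `` {last Q} \<inter> set Q)"
    using Q by (auto intro!: card_mono)
  then have "k \<le> card (E `` {hd Q} \<inter> set Q) + card (E `` {last Q} \<inter> set Q)"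
    using X[OF Q(2)] Y[OF Q(3)] \<open>k \<le> d + e\<close> by linarith
  then show ?thesis
    using long_cycle_of_path[OF assms(2-4) Q(1)] Q(4) P(4) \<open>3 \<le> k\<close> by simp
qed

lemma clique_cycle:
  assumes "finite W" "W \<subseteq> V" "2 \<le> card W" and cl: "\<And>x y. x \<in> W \<Longrightarrow> y \<in> W \<Longrightarrow> x \<noteq> y \<Longrightarrow> (x, y) \<in> E"
  shows "\<exists>c. simple_cycle V E c \<and> length c = card W"
proof -
  obtain c where c: "set c = W" "distinct c" using finite_distinct_list[OF assms(1)] by blast
  then have len: "length c = card W" using distinct_card by fastforce
  then have ne: "c \<noteq> []" using assms(3) by auto
  have "(c ! i, c ! Suc i) \<in> E" if "Suc i < length c" for i
    using that c cl[of "c ! i" "c ! Suc i"] by (auto simp: nth_eq_iff_index_eq)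
  moreover have "last c \<noteq> hd c"
    using ne c len assms(3) by (auto simp: hd_conv_nth last_conv_nth nth_eq_iff_index_eq)
  then have "(last c, hd c) \<in> E" using cl c ne by auto
  ultimately have "simple_cycle V E c"
    using c ne assms(2) by (auto simp: simple_cycle_def simple_path_def successively_conv_nth)
  then show ?thesis using len by blast
qed

text \<open>The index is \<open>h\<close> if the core \<open>W\<close> is empty, where nothing
  relates \<open>h\<close> to \<open>r\<close>. Otherwise it is \<open>k - card W\<close>, which is
  at least \<open>r\<close>.\<close>

lemma bip_pairs_bound_edge_maximal:
  assumes V: "finite V" and E: "sym E" "irrefl E" "E \<subseteq> V \<times> V" and nc: "no_cutvertex V E"
    and k: "5 \<le> k" "k \<le> card V" and st: "s \<ge> 1" "t \<ge> 1"
    and deg: "\<And>v. v \<in> V \<Longrightarrow> r \<le> card (E `` {v})"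
    and short: "\<And>c. simple_cycle V E c \<Longrightarrow> length c < k"
    and edge_max: "\<And>u v. u \<in> V \<Longrightarrow> v \<in> V \<Longrightarrow> u \<noteq> v \<Longrightarrow> (u, v) \<notin> E \<Longrightarrow>
      \<exists>P. simple_path V E P \<and> hd P = u \<and> last P = v \<and> k \<le> length P"
    and h: "h = (k - 1) div 2"
  shows "\<exists>a\<le>h. (a = h \<or> r \<le> a) \<and>
    real (card (bip_pairs s t E V)) \<le> bip_bound s t (card V) (k - a) a"
proof -
  define W where "W = core V E h"
  have WV: "W \<subseteq> V" by (simp add: W_def core_subset)
  have fW: "finite W" using WV V by (rule finite_subset)
  have hk: "2 * h + 1 \<le> k" "k \<le> 2 * h + 2" using h k by auto
  have degenerate: "real (card (bip_pairs s t E V)) \<le> bip_bound s t (card V) w a"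
    if "card (core V E a) \<le> w" "w \<le> card V" for a w
    using that outside_core_low_degree[OF V]
    by (intro card_bip_pairs_degenerate[OF V E(1,2) st core_subset]) auto
  show ?thesis
  proof (cases "W = {}")
    case True
    then show ?thesis using degenerate[of h "k - h"] k by (auto simp: W_def)
  next
    case False
    have no_path: False
      if sub: "X \<subseteq> V" "Y \<subseteq> V" and uv: "u \<in> X" "v \<in> Y" "u \<noteq> v" "(u, v) \<notin> E" and de: "k \<le> d + e"
        and X: "\<And>x. x \<in> X \<Longrightarrow> d \<le> card (E `` {x} \<inter> X)"
        and Y: "\<And>y. y \<in> Y \<Longrightarrow> e \<le> card (E `` {y} \<inter> Y)"
      for X Y u v d e
    proof -
      have "u \<in> V" "v \<in> V" using sub uv by auto
      then obtain P where P: "simple_path V E P" "hd P = u" "last P = v" "k \<le> length P"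
        using edge_max uv(3,4) by metis
      have "\<exists>c. simple_cycle V E c \<and> k \<le> length c"
        by (rule long_path_between_dense_sets[OF V E(1,2) nc sub _ X Y de P(1)]) (use P uv k in auto)
      then show False using short by (meson not_le)
    qed
    have degW: "h + 1 \<le> card (E `` {x} \<inter> W)" if "x \<in> W" for x
      using core_degree[OF V, of x E h] that unfolding W_def by simp
    \<comment> \<open>Two nonadjacent vertices of \<open>W\<close> would contradict
      \<open>no_path\<close>, because \<open>2 * (h + 1) \<ge> k\<close>.\<close>
    have clique: "(x, y) \<in> E" if "x \<in> W" "y \<in> W" "x \<noteq> y" for x y
    proof (rule ccontr)
      assume "(x, y) \<notin> E"
      then show False
        using no_path[OF WV WV that(1,2,3) _ _ degW degW] hk by simp
    qed
    define w where "w = card W"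
    define a where "a = k - w"
    obtain x where x: "x \<in> W" using False by blast
    have "E `` {x} \<inter> W \<subset> W" using x E(2) by (auto simp: irrefl_def)
    then have "card (E `` {x} \<inter> W) < w" unfolding w_def by (rule psubset_card_mono[OF fW])
    then have hw: "h + 2 \<le> w" using degW[OF x] by linarith
    obtain c where "simple_cycle V E c" "length c = w"
      using clique_cycle[OF fW WV _ clique] hw unfolding w_def by auto
    then have wk: "w < k" using short by blast
    \<comment> \<open>From \<open>w \<ge> h + 2\<close> and \<open>k \<le> 2 * h + 2\<close> follows
      \<open>a \<le> h\<close>.\<close>
    have a: "a \<le> h" "w = k - a" "k = w + a" using hw wk hk by (auto simp: a_def)
    have "W = core V E a"
    proof (rule ccontr)
      assume "W \<noteq> core V E a"
      then obtain v where v: "v \<in> core V E a" "v \<notin> W"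
        using core_antimono[OF V a(1)] unfolding W_def by blast
      \<comment> \<open>If \<open>v\<close> were adjacent to all of \<open>W\<close>, it would have
        more than \<open>h\<close> neighbours there and belong to the core \<open>W\<close>
        itself.\<close>
      have "\<exists>u\<in>W. (u, v) \<notin> E"
      proof (rule ccontr)
        assume *: "\<not> (\<exists>u\<in>W. (u, v) \<notin> E)"
        have vV: "v \<in> V" using v(1) core_subset by fastforce
        have "insert v W \<subseteq> core V E h"
        proof (rule core_greatest)
          show "insert v W \<subseteq> V" using WV vV by simp
          fix y assume y: "y \<in> insert v W"
          show "h < card (E `` {y} \<inter> insert v W)"
          proof (cases "y = v")
            case True
            have "W \<subseteq> E `` {y} \<inter> insert v W" using * E(1) True by (auto dest: symD)
            then have "w \<le> card (E `` {y} \<inter> insert v W)"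
              unfolding w_def using fW by (intro card_mono) auto
            then show ?thesis using hw by linarith
          next
            case False
            have "card (E `` {y} \<inter> W) \<le> card (E `` {y} \<inter> insert v W)"
              using WV vV by (intro card_nbhd_mono[OF V]) auto
            then show ?thesis using degW[of y] y False by force
          qed
        qed
        then show False using v(2) by (auto simp: W_def)
      qed
      then obtain u where u: "u \<in> W" "(u, v) \<notin> E" by blast
      \<comment> \<open>The clique \<open>W\<close> gives degree \<open>w - 1\<close> and the larger
        core gives \<open>a + 1\<close>. Together these are exactly \<open>k\<close>, as
        \<open>no_path\<close> requires.\<close>
      have deg1: "w - 1 \<le> card (E `` {x} \<inter> W)" if "x \<in> W" for x
      proof -
        have "W - {x} \<subseteq> E `` {x} \<inter> W" using clique that by auto
        then have "card (W - {x}) \<le> card (E `` {x} \<inter> W)" using fW by (intro card_mono) auto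
        then show ?thesis using that fW by (simp add: w_def)
      qed
      have deg2: "a + 1 \<le> card (E `` {y} \<inter> core V E a)" if "y \<in> core V E a" for y
        using core_degree[OF V that] by simp
      have "u \<noteq> v" using u(1) v(2) by auto
      moreover have "k \<le> (w - 1) + (a + 1)" using a(3) by linarith
      ultimately show False
        using no_path[OF WV core_subset u(1) v(1) _ u(2) _ deg1 deg2] by blast
    qed
    \<comment> \<open>If \<open>a < r\<close>, no vertex is ever deleted and the core
      \<open>W\<close> is all of \<open>V\<close>, although
      \<open>card W < k \<le> card V\<close>.\<close>
    moreover have "r \<le> a"
    proof (rule ccontr)
      assume "\<not> r \<le> a"
      have "a < card (E `` {v} \<inter> V)" if "v \<in> V" for v
      proof -
        have "E `` {v} \<inter> V = E `` {v}" using E(3) by auto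
        then show ?thesis using deg[OF that] \<open>\<not> r \<le> a\<close> by simp
      qed
      then have "V \<subseteq> core V E a" by (intro core_greatest) auto
      then have "V = W" using \<open>W = core V E a\<close> WV by auto
      then show False using wk k by (simp add: w_def)
    qed
    ultimately show ?thesis
      using a degenerate[of a "k - a"] k(2) by (intro exI[of _ a]) (auto simp: w_def)
  qed
qed

text \<open>The bound at \<open>r\<close> is guarded because \<open>k - r\<close> truncates. It
  enters only for \<open>r \<le> h\<close>; for larger \<open>r\<close> the index found for the
  edge-maximal graph must be \<open>h\<close>.\<close>

lemma long_cycle_of_many_bip_pairs:
  assumes V: "finite V" and E: "sym E" "irrefl E" "E \<subseteq> V \<times> V" and nc: "no_cutvertex V E"
    and k: "5 \<le> k" "k \<le> card V" and st: "s \<ge> 1" "t \<ge> 1"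
    and deg: "\<And>v. v \<in> V \<Longrightarrow> r \<le> card (E `` {v})" and h: "h = (k - 1) div 2"
    and "r \<le> k \<Longrightarrow> real (card (bip_pairs s t E V)) > bip_bound s t (card V) (k - r) r"
    and "real (card (bip_pairs s t E V)) > bip_bound s t (card V) (k - h) h"
  shows "\<exists>c. simple_cycle V E c \<and> k \<le> length c"
proof (rule ccontr)
  assume no: "\<not> ?thesis"
  obtain F where F: "E \<subseteq> F" "F \<subseteq> V \<times> V" "sym F" "irrefl F"
    "\<And>c. simple_cycle V F c \<Longrightarrow> length c < k"
    "\<And>u v. u \<in> V \<Longrightarrow> v \<in> V \<Longrightarrow> u \<noteq> v \<Longrightarrow> (u, v) \<notin> F \<Longrightarrow>
      \<exists>P. simple_path V F P \<and> hd P = u \<and> last P = v \<and> k \<le> length P"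
    by (rule edge_maximal_extension[OF V E(3,1,2), of k]) (use no k in \<open>auto simp: not_le\<close>)
  have degF: "r \<le> card (F `` {v})" if "v \<in> V" for v
  proof -
    have "finite (F `` {v})" using F(2) V by (auto intro: finite_subset[of _ V])
    then have "card (E `` {v}) \<le> card (F `` {v})" using F(1) by (intro card_mono) auto
    then show ?thesis using deg[OF that] by linarith
  qed
  obtain a where a: "a \<le> h" "a = h \<or> r \<le> a"
    "real (card (bip_pairs s t F V)) \<le> bip_bound s t (card V) (k - a) a"
    using bip_pairs_bound_edge_maximal[OF V F(3,4,2) no_cutvertex_mono[OF nc F(1)] k st degF F(5,6) h]
    by blast
  define f where "f b = bip_bound s t (card V) (k - b) b" for b
  have hk: "2 * h + 1 \<le> k" using h k by auto
  have conv: "2 * f (b + 1) \<le> f b + f (b + 2)" if "b + 2 \<le> h" for b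
    unfolding f_def using that hk k by (intro bip_bound_convex st) auto
  have "r \<le> h \<and> f a \<le> max (f r) (f h) \<or> f a \<le> f h"
    using a(1,2) conv convex_seq_le_max[of r a h f] by auto
  moreover have "card (bip_pairs s t E V) \<le> card (bip_pairs s t F V)"
    using V F(1) by (rule card_bip_pairs_mono)
  ultimately show False
    using a(3) assms(12,13) hk unfolding f_def by (auto simp: le_max_iff_disj)
qed

section \<open>Pair graphs\<close>

lemma simple_path_of_reachable:
  assumes "(u, v) \<in> rtrancl_on S R" and "R \<subseteq> E \<inter> S \<times> S" "S \<subseteq> V"
  shows "\<exists>W. simple_path V E W \<and> hd W = u \<and> last W = v \<and> set W \<subseteq> S"
  using assms(1)
proof (induction rule: rtrancl_on_induct)
  case base
  then show ?case using assms(3) by (intro exI[of _ "[u]"]) (auto simp: simple_path_def)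
next
  case (step v w)
  then obtain W where W: "simple_path V E W" "hd W = u" "last W = v" "set W \<subseteq> S" by blast
  have vw: "(v, w) \<in> E" "w \<in> S" using step assms(2) by auto
  show ?case
  proof (cases "w \<in> set W")
    \<comment> \<open>The walk returns to a vertex of the path, so the path is cut back to
      it.\<close>
    case True
    then obtain X Y where XY: "W = X @ w # Y" by (meson split_list)
    then have "simple_path V E (X @ [w])"
      using W(1) simple_path_appendD1[of V E "X @ [w]" Y] by simp
    moreover have "hd (X @ [w]) = u" using W(2) XY by (cases X) auto
    ultimately show ?thesis using W(4) XY by (intro exI[of _ "X @ [w]"]) auto
  next
    case False
    have "simple_path V E (W @ [w])"
      using W vw False assms(3) by (intro simple_path_snoc) auto
    then show ?thesis
      using W vw simple_pathD(1)[OF W(1)] by (intro exI[of _ "W @ [w]"]) auto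
  qed
qed

lemma (in pair_graph) no_cutvertex_of_2_connected:
  assumes "k_connected 2 (with_proj G)"
  shows "no_cutvertex (pverts G) (parcs G)"
  unfolding no_cutvertex_def
proof (intro ballI)
  fix y u v assume y: "y \<in> pverts G" and uv: "u \<in> pverts G - {y}" "v \<in> pverts G - {y}"
  let ?S = "pverts G - {y}"
  let ?H = "mk_symmetric (with_proj G \<restriction> ?S)"
  have "connected (with_proj G \<restriction> ?S)"
    using assms y unfolding k_connected_def
    by (metis card_0_eq card_insert_disjoint empty_iff finite.emptyI One_nat_def bot_least insert_subset
        lessI numeral_2_eq_2 with_proj_simps(1) card.empty)
  then have "(u, v) \<in> rtrancl_on ?S (parcs ?H)"
    using uv by (auto simp: connected_def strongly_connected_def reachable_def mk_symmetric_def)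
  \<comment> \<open>The arcs are symmetric already, so the symmetric closure in the notion of
    connectedness adds none.\<close>
  moreover have "parcs ?H \<subseteq> parcs G \<inter> ?S \<times> ?S"
    using arcs_symmetric by (fastforce simp: mk_symmetric_def)
  ultimately obtain W where "simple_path (pverts G) (parcs G) W" "hd W = u" "last W = v" "set W \<subseteq> ?S"
    using simple_path_of_reachable[of u v ?S _ "parcs G" "pverts G"] by blast
  then show "\<exists>W. simple_path (pverts G) (parcs G) W \<and> hd W = u \<and> last W = v \<and> y \<notin> set W"
    by blast
qed

lemma (in pair_graph) min_degree_le_card_nbhd:
  assumes "v \<in> pverts G"
  shows "min_degree (with_proj G) \<le> card (parcs G `` {v})"
proof -
  have "min_degree (with_proj G) \<le> out_degree (with_proj G) v"
    using assms pair_finite_verts unfolding min_degree_def by (intro Min_le) auto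
  also have "out_arcs (with_proj G) v = Pair v ` (parcs G `` {v})"
    by (auto simp: out_arcs_def)
  then have "out_degree (with_proj G) v = card (parcs G `` {v})"
    by (simp add: out_degree_def card_image inj_on_def)
  finally show ?thesis .
qed

text \<open>\<open>zip c (tl c @ [z])\<close> lists the arcs of the walk through the vertices
  \<open>c\<close> that ends in \<open>z\<close>. Taking \<open>z = hd c\<close> closes it.\<close>

lemma pcas_zip:
  "c \<noteq> [] \<Longrightarrow> pcas (hd c) (zip c (tl c @ [z])) z"
proof (induction c)
  case (Cons x c)
  then show ?case by (cases c) auto
qed simp

lemma pawalk_verts_zip:
  "c \<noteq> [] \<Longrightarrow> pawalk_verts (hd c) (zip c (tl c @ [z])) = c @ [z]"
proof (induction c)
  case (Cons x c)
  then show ?case by (cases c) auto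
qed simp

lemma set_zip_successively:
  "successively (\<lambda>x y. (x, y) \<in> E) c \<Longrightarrow> c \<noteq> [] \<Longrightarrow> (last c, z) \<in> E \<Longrightarrow>
    set (zip c (tl c @ [z])) \<subseteq> E"
proof (induction c)
  case (Cons x c)
  then show ?case by (cases c) auto
qed simp

lemma (in pair_graph) cycle_of_simple_cycle:
  assumes "simple_cycle (pverts G) (parcs G) c"
  shows "\<exists>p. cycle p \<and> length p = length c"
proof -
  let ?p = "zip c (tl c @ [hd c])"
  have c: "c \<noteq> []" "distinct c" "set c \<subseteq> pverts G" "hd c \<in> pverts G"
      "successively (\<lambda>x y. (x, y) \<in> parcs G) c" "(last c, hd c) \<in> parcs G"
    using assms hd_in_set[of c] by (auto simp: simple_cycle_def simple_path_def)
  have "awalk (hd c) ?p (hd c)"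
    using pcas_zip[OF c(1)] set_zip_successively[OF c(5,1,6)] c(4) by (simp add: awalk_def)
  moreover have "distinct (tl (pawalk_verts (hd c) ?p))"
    unfolding pawalk_verts_zip[OF c(1)] using c(1,2) by (cases c) auto
  moreover have "length ?p = length c" using c(1) by simp
  ultimately show ?thesis
    using c(1) unfolding cycle_def by (metis length_0_conv)
qed

lemma (in pair_graph) num_bipartite_copies_le:
  assumes "s \<ge> 1"
  shows "(if s = t then 2 else 1) * num_bipartite_copies s t G \<le>
    card (bip_pairs s t (parcs G) (pverts G))"
proof -
  let ?B = "bip_pairs s t (parcs G) (pverts G)"
  define \<H> where "\<H> = {H :: 'a pair_pre_digraph.
    subgraph (with_proj H) (with_proj G) \<and> complete_bipartite_digraph s t (with_proj H)}"
  define f where "f = (\<lambda>(S, T). \<lparr>pverts = S \<union> T, parcs = S \<times> T \<union> T \<times> S\<rparr> :: 'a pair_pre_digraph)"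
  have finB: "finite ?B" using pair_finite_verts by simp
  have "\<forall>H\<in>\<H>. \<exists>z. z \<in> ?B \<and> f z = H"
  proof
    fix H assume "H \<in> \<H>"
    then obtain S T where "pverts H = S \<union> T" "card S = s" "card T = t" "parcs H = S \<times> T \<union> T \<times> S"
      and "pverts H \<subseteq> pverts G" "parcs H \<subseteq> parcs G"
      unfolding \<H>_def complete_bipartite_digraph_pair_def subgraph_def by auto
    then show "\<exists>z. z \<in> ?B \<and> f z = H"
      by (intro exI[of _ "(S, T)"]) (auto simp: bip_pairs_def f_def)
  qed
  then obtain w where w: "\<And>H. H \<in> \<H> \<Longrightarrow> w H \<in> ?B" "\<And>H. H \<in> \<H> \<Longrightarrow> f (w H) = H" by metis
  then have inj: "inj_on w \<H>" by (metis inj_onI)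
  have sub: "w ` \<H> \<subseteq> ?B" using w by auto
  have num: "num_bipartite_copies s t G = card (w ` \<H>)"
    using inj by (simp add: num_bipartite_copies_def \<H>_def card_image)
  show ?thesis
  proof (cases "s = t")
    case False
    then show ?thesis using num card_mono[OF finB sub] by simp
  next
    case True
    have fin: "finite (w ` \<H>)" using finB sub by (rule rev_finite_subset)
    have symE: "sym (parcs G)" using arcs_symmetric by (auto simp: sym_def)
    have swap: "prod.swap ` w ` \<H> \<subseteq> ?B"
    proof
      fix z assume "z \<in> prod.swap ` w ` \<H>"
      then have "prod.swap z \<in> ?B" using sub by auto
      then show "z \<in> ?B"
        using bip_pairs_swap[OF symE, of "fst z" "snd z" s s] True by (simp add: prod.swap_def)
    qed
    \<comment> \<open>A common pair would have two equal sides, and a nonempty \<open>S\<close> with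
      \<open>S \<times> S\<close> among the arcs yields a loop.\<close>
    have "w ` \<H> \<inter> prod.swap ` w ` \<H> = {}"
    proof (rule ccontr)
      assume "w ` \<H> \<inter> prod.swap ` w ` \<H> \<noteq> {}"
      then obtain H K where HK: "H \<in> \<H>" "K \<in> \<H>" "w H = prod.swap (w K)" by blast
      have "f (prod.swap z) = f z" for z by (auto simp: f_def split: prod.splits)
      then have "H = K" using w(2)[OF HK(1)] w(2)[OF HK(2)] HK(3) by metis
      then obtain S where S: "w H = (S, S)" using HK(3) by (metis prod.swap_def prod.collapse prod.inject)
      then have "S \<times> S \<subseteq> parcs G" "card S = s" using w(1)[OF HK(1)] by (auto simp: bip_pairs_def)
      moreover from this have "S \<noteq> {}" using assms by auto
      ultimately show False using pair_no_loops by fastforce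
    qed
    then have "card (w ` \<H>) + card (prod.swap ` w ` \<H>) \<le> card ?B"
      using fin finB sub swap card_mono[OF finB, of "w ` \<H> \<union> prod.swap ` w ` \<H>"]
      by (simp add: card_Un_disjoint)
    moreover have "card (prod.swap ` w ` \<H>) = card (w ` \<H>)"
      by (intro card_image) simp
    ultimately show ?thesis using num True by simp
  qed
qed

theorem theorem2p4:
  fixes s t :: nat and n k r h :: int and G :: "'a pair_pre_digraph"
  assumes "s \<ge> 1" and "t \<ge> 1"
    and "n \<ge> k" and "k \<ge> 5" and "r \<ge> 2"
    and "pair_graph G"
    and "int (card (pverts G)) = n"
    and "k_connected 2 (with_proj G)"
    and "int (min_degree (with_proj G)) \<ge> r"
    and "h = \<lfloor>(real_of_int k - 1) / 2\<rfloor>"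
    and "real (num_bipartite_copies s t G) > max (g s t n k r) (g s t n k h)"
  shows "\<exists>p. pre_digraph.cycle (with_proj G) p \<and> int (length p) \<ge> k"
proof -
  interpret pair_graph G by fact
  let ?V = "pverts G" and ?E = "parcs G"
  define K where "K = nat k"
  define R where "R = nat r"
  define H where "H = (K - 1) div 2"
  have "(real_of_int k - 1) / 2 = real_of_int (k - 1) / real_of_int 2" by simp
  then have "h = (k - 1) div 2" using assms(10) by (simp only: floor_divide_of_int_eq)
  then have eqs: "k = int K" "r = int R" "h = int H" "n = int (card ?V)"
    using assms by (auto simp: K_def R_def H_def)
  have K: "5 \<le> K" "K \<le> card ?V" "H \<le> K" using assms(3,4) eqs by (auto simp: H_def)
  \<comment> \<open>The factor \<open>?c\<close> accounts for the two orderings of the sides of a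
    copy when \<open>s = t\<close>.\<close>
  let ?B = "bip_pairs s t ?E ?V" and ?c = "if s = t then 2 else (1 :: real)"
  have num: "?c * real (num_bipartite_copies s t G) \<le> real (card ?B)"
    using num_bipartite_copies_le[OF assms(1), of t] by (auto split: if_splits)
  have bound: "bip_bound s t (card ?V) (K - a) a < real (card ?B)"
    if "a \<le> K" "g s t n k (int a) < real (num_bipartite_copies s t G)" for a
  proof -
    have "?c * g s t n k (int a) < ?c * real (num_bipartite_copies s t G)"
      using that(2) by auto
    then show ?thesis
      using num g_eq_bip_bound[OF assms(1,2) that(1) K(2)] eqs by (simp del: of_nat_less_iff)
  qed
  have E: "sym ?E" "irrefl ?E" "?E \<subseteq> ?V \<times> ?V"
    using arcs_symmetric pair_no_loops[of "(_, _)"] in_arcsD1 in_arcsD2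
    by (auto simp: sym_def irrefl_def)
  have deg: "R \<le> card (?E `` {v})" if "v \<in> ?V" for v
    using min_degree_le_card_nbhd[OF that] assms(9) eqs by linarith
  obtain c where c: "simple_cycle ?V ?E c" "K \<le> length c"
    using long_cycle_of_many_bip_pairs[OF pair_finite_verts E no_cutvertex_of_2_connected[OF assms(8)]
        K(1,2) assms(1,2) deg H_def bound bound[OF K(3)]] assms(11) eqs
    by (auto simp: max_less_iff_conj)
  obtain p where "cycle p" "length p = length c" using cycle_of_simple_cycle[OF c(1)] by blast
  then show ?thesis using c(2) eqs by auto
qed

end
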